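(* Let $c,\widetilde{\omega}\in\mathbb{C}\setminus\{0\}$ be constants, and let $q,Q,u,v$ be polynomials in $z$ with complex coefficients such that $Q$ and $v$ are not constant and $q\not\equiv 0$, $u\not\equiv 0$. Suppose that $f$ is a transcendental entire function of finite order which satisfies $$f^{2}(z)+\widetilde{\omega}\, f(z)f'(z)+q(z)e^{Q(z)}f(z+c)=u(z)e^{v(z)}\qquad (z\in\mathbb{C})$$ and $\lambda(f)<\sigma(f)$. Then $\deg Q=\deg v$, and one of the following holds: (1) $\sigma(f)<\deg Q=\deg v$, and $f(z)=Ce^{-z/\widetilde{\omega}}$ for some constant $C$; (2) $\sigma(f)=\deg Q=\deg v$.
   Context: For an entire function $f$, with Nevanlinna characteristic $T(r,f)$, $\sigma(f)=\limsup_{r\to\infty}\frac{\log^{+} T(r,f)}{\log r}$ denotes the order of growth of $f$, and $\lambda(f)=\limsup_{r\to\infty}\frac{\log^{+} N(r,1/f)}{\log r}$ denotes the exponent of convergence of the zeros of $f$, where $N(r,1/f)$ is the (integrated) Nevanlinna counting function of the zeros of $f$ with multiplicity. *)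

theory Defs
  imports "HOL-Complex_Analysis.Complex_Analysis"
begin

text \<open>
  The functionals below are meant for a meromorphic function \<open>g\<close> on the complex plane. The
  values of \<open>g\<close> at its poles are irrelevant, so \<open>\<lambda>z. 1 / f z\<close> is an admissible argument even
  though division by zero returns zero: its poles are the zeros of \<open>f\<close>.
\<close>

definition log_plus :: "real \<Rightarrow> real" where
  "log_plus x = ln (max 1 x)"

definition proximity :: "real \<Rightarrow> (complex \<Rightarrow> complex) \<Rightarrow> real" where
  "proximity r g =
     1 / (2 * pi) * integral {0..2 * pi} (\<lambda>\<theta>. log_plus (cmod (g (of_real r * cis \<theta>))))"

text \<open>The order of \<open>g\<close> at a pole is negative, so \<open>- zorder g z\<close> is the multiplicity of the pole.\<close>

definition pole_count :: "real \<Rightarrow> (complex \<Rightarrow> complex) \<Rightarrow> nat" where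
  "pole_count t g = (\<Sum>z\<in>{z. cmod z \<le> t \<and> is_pole g z}. nat (- zorder g z))"

definition counting_N :: "real \<Rightarrow> (complex \<Rightarrow> complex) \<Rightarrow> real" where
  "counting_N r g =
     integral {0..r} (\<lambda>t. (real (pole_count t g) - real (pole_count 0 g)) / t)
       + real (pole_count 0 g) * ln r"

definition nevanlinna_T :: "real \<Rightarrow> (complex \<Rightarrow> complex) \<Rightarrow> real" where
  "nevanlinna_T r g = proximity r g + counting_N r g"

definition growth_order :: "(complex \<Rightarrow> complex) \<Rightarrow> ereal" where
  "growth_order f = Limsup at_top (\<lambda>r::real. ereal (log_plus (nevanlinna_T r f) / ln r))"

definition zeros_exponent :: "(complex \<Rightarrow> complex) \<Rightarrow> ereal" where
  "zeros_exponent f =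
     Limsup at_top (\<lambda>r::real. ereal (log_plus (counting_N r (\<lambda>z. 1 / f z)) / ln r))"

definition transcendental_entire :: "(complex \<Rightarrow> complex) \<Rightarrow> bool" where
  "transcendental_entire f \<longleftrightarrow>
     f holomorphic_on UNIV \<and> \<not> (\<exists>p :: complex poly. \<forall>z. f z = poly p z)"

end

theory Submission imports Defs begin

text \<open>
  Since \<open>\<lambda>(f) < \<sigma>(f) < \<infinity>\<close>, Hadamard's theorem gives \<open>f = P exp p\<close> with a polynomial \<open>p\<close> of degree
  \<open>k = \<sigma>(f)\<close> and an entire \<open>P\<close> of order below \<open>k\<close>. The equation becomes
  \<open>A exp (2 p) + B exp (Q + p(z + c)) = u exp v\<close> with \<open>A = P (P + \<omega> (P' + p' P))\<close> and
  \<open>B = q P(z + c)\<close> of order below \<open>k\<close>. If \<open>A\<close> is not identically zero, then Borel's theorem on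
  exponential sums forces the three exponents to agree up to degree \<open>k - 1\<close>, and comparing
  coefficients of \<open>z^k\<close> gives \<open>deg Q = deg v = k\<close>. If \<open>A\<close> vanishes, then \<open>f + \<omega> f' = 0\<close>, so
  \<open>f = C exp (- z / \<omega>)\<close> and \<open>Q - z / \<omega> - v\<close> is constant.

  For Hadamard's theorem let \<open>P\<close> be the canonical product of the zeros and \<open>f / P = exp g\<close>. Jensen's
  inequality for \<open>P\<close> bounds the mean of \<open>\<bar>Re g\<bar>\<close> on a circle of radius \<open>r\<close> by
  \<open>4 m(r, f) + O(r^\<tau>)\<close> with \<open>\<tau> < \<sigma>(f)\<close>, and that mean controls the Taylor coefficients of \<open>g\<close>.
\<close>

section \<open>Entire functions of finite type\<close>

text \<open>A working substitute for the order of growth: order at most \<open>\<rho>\<close>, with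
  an unspecified type \<open>C\<close>. Using \<open>1 + cmod z\<close> instead of
  \<open>cmod z\<close> keeps the power at least 1 when \<open>\<rho> \<ge> 0\<close>, so that
  constants and sums stay in the class.\<close>

definition finite_type :: "real \<Rightarrow> (complex \<Rightarrow> complex) \<Rightarrow> bool" where
  "finite_type \<rho> a \<longleftrightarrow>
     a holomorphic_on UNIV \<and> (\<exists>C. \<forall>z. cmod (a z) \<le> exp (C * (1 + cmod z) powr \<rho>))"

lemma finite_type_holomorphic: "finite_type \<rho> a \<Longrightarrow> a holomorphic_on A"
  unfolding finite_type_def using holomorphic_on_subset by blast

lemma finite_typeE:
  assumes "finite_type \<rho> a"
  obtains C where "C \<ge> 0" "\<And>z. cmod (a z) \<le> exp (C * (1 + cmod z) powr \<rho>)"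
proof -
  obtain C where C: "\<And>z. cmod (a z) \<le> exp (C * (1 + cmod z) powr \<rho>)"
    using assms by (auto simp: finite_type_def)
  have "cmod (a z) \<le> exp (max C 0 * (1 + cmod z) powr \<rho>)" for z
    using C[of z] by (rule order_trans) (auto intro!: mult_right_mono)
  then show ?thesis by (intro that[of "max C 0"]) auto
qed

lemma finite_typeI:
  assumes "a holomorphic_on UNIV" "\<And>z. cmod (a z) \<le> exp (C * (1 + cmod z) powr \<rho>)"
  shows "finite_type \<rho> a"
  using assms by (auto simp: finite_type_def)

lemma one_le_one_plus_norm_powr: "\<rho> \<ge> 0 \<Longrightarrow> 1 \<le> (1 + cmod z) powr \<rho>"
  by (rule ge_one_powr_ge_zero) auto

lemma finite_type_mono:
  assumes "finite_type \<rho> a" "\<rho> \<le> \<rho>'"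
  shows "finite_type \<rho>' a"
proof -
  obtain C where C: "C \<ge> 0" "\<And>z. cmod (a z) \<le> exp (C * (1 + cmod z) powr \<rho>)"
    using finite_typeE[OF assms(1)] by blast
  show ?thesis
  proof (rule finite_typeI[of _ C])
    show "cmod (a z) \<le> exp (C * (1 + cmod z) powr \<rho>')" for z
      using C(2)[of z] by (rule order_trans) (use assms C(1) in \<open>auto intro!: mult_left_mono powr_mono\<close>)
  qed (use assms finite_type_holomorphic in auto)
qed

section \<open>Closure properties of the class \<open>finite_type\<close>\<close>

lemma finite_type_const [intro, simp]:
  assumes "\<rho> \<ge> 0"
  shows "finite_type \<rho> (\<lambda>_. c)"
proof (rule finite_typeI[of _ "cmod c"])
  fix z
  have "cmod c \<le> exp (cmod c)" using exp_ge_add_one_self[of "cmod c"] by linarith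
  also have "\<dots> \<le> exp (cmod c * (1 + cmod z) powr \<rho>)"
    using one_le_one_plus_norm_powr[OF assms, of z] by (simp add: mult_le_cancel_left1)
  finally show "cmod c \<le> exp (cmod c * (1 + cmod z) powr \<rho>)" .
qed auto

lemma finite_type_ident [intro, simp]:
  assumes "\<rho> > 0"
  shows "finite_type \<rho> (\<lambda>z. z)"
proof (rule finite_typeI[of _ "1 / \<rho>"])
  fix z
  have "cmod z \<le> exp (ln (1 + cmod z))" by (subst exp_ln) (auto intro: add_pos_nonneg)
  also have "ln (1 + cmod z) \<le> (1 + cmod z) powr \<rho> / \<rho>"
    by (rule ln_powr_bound) (use assms in auto)
  finally show "cmod z \<le> exp (1 / \<rho> * (1 + cmod z) powr \<rho>)" by simp
qed (auto intro: holomorphic_intros)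

lemma finite_type_mult [intro]:
  assumes "finite_type \<rho> a" "finite_type \<rho> b"
  shows "finite_type \<rho> (\<lambda>z. a z * b z)"
proof -
  obtain C where C: "C \<ge> 0" "\<And>z. cmod (a z) \<le> exp (C * (1 + cmod z) powr \<rho>)"
    using finite_typeE[OF assms(1)] by blast
  obtain D where D: "D \<ge> 0" "\<And>z. cmod (b z) \<le> exp (D * (1 + cmod z) powr \<rho>)"
    using finite_typeE[OF assms(2)] by blast
  show ?thesis
  proof (rule finite_typeI[of _ "C + D"])
    show "cmod (a z * b z) \<le> exp ((C + D) * (1 + cmod z) powr \<rho>)" for z
      unfolding norm_mult distrib_right exp_add by (intro mult_mono C D) auto
  qed (use assms finite_type_holomorphic in \<open>auto intro!: holomorphic_intros\<close>)
qed

lemma finite_type_add [intro]: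
  assumes "\<rho> \<ge> 0" "finite_type \<rho> a" "finite_type \<rho> b"
  shows "finite_type \<rho> (\<lambda>z. a z + b z)"
proof -
  obtain C where C: "C \<ge> 0" "\<And>z. cmod (a z) \<le> exp (C * (1 + cmod z) powr \<rho>)"
    using finite_typeE[OF assms(2)] by blast
  obtain D where D: "D \<ge> 0" "\<And>z. cmod (b z) \<le> exp (D * (1 + cmod z) powr \<rho>)"
    using finite_typeE[OF assms(3)] by blast
  show ?thesis
  proof (rule finite_typeI[of _ "1 + C + D"])
    fix z
    define X where "X = (1 + cmod z) powr \<rho>"
    have X: "X \<ge> 1" unfolding X_def using assms(1) by (rule one_le_one_plus_norm_powr)
    have "cmod (a z + b z) \<le> exp (C * X) + exp (D * X)"
      using norm_triangle_ineq[of "a z" "b z"] C(2)[of z] D(2)[of z] unfolding X_def by linarith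
    also have "\<dots> \<le> exp ((C + D) * X) + exp ((C + D) * X)"
      using C D X by (intro add_mono) auto
    also have "\<dots> = 2 * exp ((C + D) * X)" by simp
    \<comment> \<open>Here \<open>2 \<le> 1 + X \<le> exp X\<close> because
      \<open>X \<ge> 1\<close>; this is where the summand 1 in \<open>1 + C + D\<close> comes
      from.\<close>
    also have "\<dots> \<le> exp X * exp ((C + D) * X)"
      using exp_ge_add_one_self[of X] X by (intro mult_right_mono) (linarith, simp)
    also have "\<dots> = exp ((1 + C + D) * X)" by (simp add: exp_add[symmetric] algebra_simps)
    finally show "cmod (a z + b z) \<le> exp ((1 + C + D) * (1 + cmod z) powr \<rho>)"
      unfolding X_def .
  qed (use assms finite_type_holomorphic in \<open>auto intro!: holomorphic_intros\<close>)
qed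

lemma finite_type_diff [intro]:
  assumes "\<rho> \<ge> 0" "finite_type \<rho> a" "finite_type \<rho> b"
  shows "finite_type \<rho> (\<lambda>z. a z - b z)"
proof -
  have "finite_type \<rho> (\<lambda>z. a z + (-1) * b z)"
    using assms by (intro finite_type_add finite_type_mult finite_type_const)
  then show ?thesis by simp
qed

lemma finite_type_power [intro]:
  assumes "\<rho> \<ge> 0" "finite_type \<rho> a"
  shows "finite_type \<rho> (\<lambda>z. a z ^ n)"
  by (induction n) (use assms in \<open>auto intro!: finite_type_mult\<close>)

lemma finite_type_prod:
  assumes "\<rho> \<ge> 0" "\<And>i. i \<in> I \<Longrightarrow> finite_type \<rho> (a i)"
  shows "finite_type \<rho> (\<lambda>z. \<Prod>i\<in>I. a i z)"
  using assms(2) by (induction I rule: infinite_finite_induct) (use assms(1) in \<open>auto intro!: finite_type_mult\<close>)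

lemma finite_type_poly [intro]:
  assumes "\<rho> > 0"
  shows "finite_type \<rho> (poly p)"
proof (induction p)
  case 0
  then show ?case using assms finite_type_const[of \<rho> 0] by (simp add: fun_eq_iff)
next
  case (pCons c p)
  have "finite_type \<rho> (\<lambda>z. c + z * poly p z)"
    using assms pCons by (intro finite_type_add finite_type_mult finite_type_const finite_type_ident) simp_all
  then show ?case by (simp add: fun_eq_iff)
qed

text \<open>In this multiplicative form a translation costs only the factor
  \<open>(1 + cmod c) powr \<rho>\<close> in the type.\<close>

lemma one_plus_norm_add_le: "1 + cmod (z + c) \<le> (1 + cmod c) * (1 + cmod z)"
proof -
  have "0 \<le> cmod c * cmod z" by simp
  moreover have "cmod (z + c) \<le> cmod z + cmod c" by (rule norm_triangle_ineq)
  ultimately show ?thesis unfolding distrib_left distrib_right mult_1_left mult_1_right by linarith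
qed

lemma finite_type_shift:
  assumes "\<rho> \<ge> 0" "finite_type \<rho> a"
  shows "finite_type \<rho> (\<lambda>z. a (z + c))"
proof -
  obtain C where C: "C \<ge> 0" "\<And>z. cmod (a z) \<le> exp (C * (1 + cmod z) powr \<rho>)"
    using finite_typeE[OF assms(2)] by blast
  show ?thesis
  proof (rule finite_typeI[of _ "C * (1 + cmod c) powr \<rho>"])
    fix z
    have "(1 + cmod (z + c)) powr \<rho> \<le> ((1 + cmod c) * (1 + cmod z)) powr \<rho>"
      using assms(1) by (intro powr_mono2 one_plus_norm_add_le) auto
    also have "\<dots> = (1 + cmod c) powr \<rho> * (1 + cmod z) powr \<rho>" by (rule powr_mult)
    finally have "C * (1 + cmod (z + c)) powr \<rho> \<le> C * (1 + cmod c) powr \<rho> * (1 + cmod z) powr \<rho>"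
      using C(1) by (simp add: mult_left_mono mult.assoc)
    then show "cmod (a (z + c)) \<le> exp (C * (1 + cmod c) powr \<rho> * (1 + cmod z) powr \<rho>)"
      using C(2)[of "z + c"] by (meson exp_le_cancel_iff order_trans)
    show "(\<lambda>z. a (z + c)) holomorphic_on UNIV"
      using holomorphic_on_compose[of "\<lambda>z. z + c" UNIV a] finite_type_holomorphic[OF assms(2)]
      by (simp add: o_def holomorphic_intros)
  qed
qed

text \<open>Cauchy's estimate on the unit circle about \<open>z\<close>: there
  \<open>1 + cmod w\<close> is at most twice \<open>1 + cmod z\<close>, which costs the factor
  \<open>2 powr \<rho>\<close>.\<close>

lemma finite_type_deriv [intro]:
  assumes "\<rho> \<ge> 0" "finite_type \<rho> a"
  shows "finite_type \<rho> (deriv a)"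
proof -
  obtain C where C: "C \<ge> 0" "\<And>z. cmod (a z) \<le> exp (C * (1 + cmod z) powr \<rho>)"
    using finite_typeE[OF assms(2)] by blast
  show ?thesis
  proof (rule finite_typeI[of _ "C * 2 powr \<rho>"])
    fix z
    have "cmod ((deriv ^^ 1) a z) \<le> (fact 1) * exp (C * 2 powr \<rho> * (1 + cmod z) powr \<rho>) / 1 ^ 1"
    proof (rule Cauchy_inequality)
      show "continuous_on (cball z 1) a"
        using finite_type_holomorphic[OF assms(2)] holomorphic_on_imp_continuous_on by blast
      fix w assume w: "cmod (z - w) = 1"
      have "cmod w \<le> cmod z + cmod (z - w)" by norm
      then have "1 + cmod w \<le> 2 * (1 + cmod z)" using w norm_ge_zero[of z] by argo
      then have "(1 + cmod w) powr \<rho> \<le> (2 * (1 + cmod z)) powr \<rho>"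
        using assms(1) by (intro powr_mono2) auto
      also have "\<dots> = 2 powr \<rho> * (1 + cmod z) powr \<rho>" by (rule powr_mult)
      finally have "C * (1 + cmod w) powr \<rho> \<le> C * 2 powr \<rho> * (1 + cmod z) powr \<rho>"
        using C(1) by (simp add: mult_left_mono mult.assoc)
      then show "cmod (a w) \<le> exp (C * 2 powr \<rho> * (1 + cmod z) powr \<rho>)"
        using C(2)[of w] by (meson exp_le_cancel_iff order_trans)
    qed (use finite_type_holomorphic[OF assms(2)] in auto)
    then show "cmod (deriv a z) \<le> exp (C * 2 powr \<rho> * (1 + cmod z) powr \<rho>)" by simp
    show "deriv a holomorphic_on UNIV"
      using finite_type_holomorphic[OF assms(2)] by (intro holomorphic_deriv) auto
  qed
qed

lemma poly_norm_bound:
  fixes p :: "complex poly"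
  assumes "degree p \<le> d"
  obtains K where "K \<ge> 0" "\<And>z. cmod (poly p z) \<le> K * (1 + cmod z) ^ d"
proof
  show "0 \<le> (\<Sum>i\<le>degree p. cmod (coeff p i))" by (intro sum_nonneg) auto
  fix z
  have "cmod (poly p z) \<le> (\<Sum>i\<le>degree p. cmod (coeff p i * z ^ i))"
    unfolding poly_altdef by (rule norm_sum)
  also have "\<dots> \<le> (\<Sum>i\<le>degree p. cmod (coeff p i) * (1 + cmod z) ^ d)"
  proof (intro sum_mono)
    fix i assume i: "i \<in> {..degree p}"
    have "cmod z ^ i \<le> (1 + cmod z) ^ i" by (intro power_mono) auto
    also have "\<dots> \<le> (1 + cmod z) ^ d" using i assms by (intro power_increasing) auto
    finally show "cmod (coeff p i * z ^ i) \<le> cmod (coeff p i) * (1 + cmod z) ^ d"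
      by (simp add: norm_mult norm_power mult_left_mono)
  qed
  finally show "cmod (poly p z) \<le> (\<Sum>i\<le>degree p. cmod (coeff p i)) * (1 + cmod z) ^ d"
    by (simp add: sum_distrib_right)
qed

lemma finite_type_exp_poly:
  assumes "real (degree p) \<le> \<rho>"
  shows "finite_type \<rho> (\<lambda>z. exp (poly p z))"
proof -
  obtain K where K: "K \<ge> 0" "\<And>z. cmod (poly p z) \<le> K * (1 + cmod z) ^ degree p"
    using poly_norm_bound[OF order_refl] by blast
  show ?thesis
  proof (rule finite_typeI[of _ K])
    fix z
    have "Re (poly p z) \<le> K * (1 + cmod z) ^ degree p"
      using complex_Re_le_cmod K(2) order_trans by blast
    also have "(1 + cmod z) ^ degree p = (1 + cmod z) powr (degree p)"
      by (subst powr_realpow) (auto intro: add_pos_nonneg)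
    also have "K * \<dots> \<le> K * (1 + cmod z) powr \<rho>"
      using assms K(1) by (intro mult_left_mono powr_mono) auto
    finally show "cmod (exp (poly p z)) \<le> exp (K * (1 + cmod z) powr \<rho>)" by simp
  qed (auto intro!: holomorphic_intros)
qed

section \<open>Borel's theorem for three exponentials\<close>

text \<open>The four real parts are \<open>Re w\<close>, \<open>- Im w\<close>,
  \<open>- Re w\<close> and \<open>Im w\<close>, and the moduli of \<open>Re w\<close> and
  \<open>Im w\<close> add up to at least \<open>cmod w\<close>.\<close>

lemma ex_quarter_turn_Re_ge:
  obtains j where "j < (4::nat)" "Re (w * \<i> ^ j) \<ge> cmod w / 2"
proof -
  have "cmod w \<le> \<bar>Re w\<bar> + \<bar>Im w\<bar>" by (rule cmod_le)
  then consider "Re w \<ge> cmod w / 2" | "- Im w \<ge> cmod w / 2" | "- Re w \<ge> cmod w / 2" | "Im w \<ge> cmod w / 2"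
    by linarith
  then show ?thesis
    by cases (use that[of 0] that[of 1] that[of 2] that[of 3] in \<open>simp_all add: numeral_3_eq_3\<close>)
qed

lemma powr_sub_power_at_bot:
  fixes K c s :: real
  assumes "c > 0" "s < real d" "d > 0"
  shows "filterlim (\<lambda>r. K * (1 + r) powr s - c * r ^ d) at_bot at_top"
proof -
  have lim: "((\<lambda>r. (1 + r) powr s / r powr d) \<longlongrightarrow> 0) at_top"
    using assms(2) by real_asymp
  have "((\<lambda>r. K * ((1 + r) powr s / r powr d) - c) \<longlongrightarrow> K * 0 - c) at_top"
    by (intro tendsto_intros lim)
  then have 1: "((\<lambda>r. K * ((1 + r) powr s / r powr d) - c) \<longlongrightarrow> - c) at_top" by simp
  have 2: "filterlim (\<lambda>r::real. r ^ d) at_top at_top"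
    using assms(3) by real_asymp
  have "filterlim (\<lambda>r. (K * ((1 + r) powr s / r powr d) - c) * r ^ d) at_bot at_top"
    by (rule filterlim_tendsto_neg_mult_at_bot[OF 1 _ 2]) (use assms in auto)
  moreover have "eventually (\<lambda>r. (K * ((1 + r) powr s / r powr d) - c) * r ^ d =
      K * (1 + r) powr s - c * r ^ d) at_top"
    using eventually_gt_at_top[of 0]
    by eventually_elim (simp add: powr_realpow field_simps)
  ultimately show ?thesis by (simp cong: filterlim_cong)
qed

text \<open>On every circle one of the \<open>4 d\<close> rotations by \<open>pi / (2 d)\<close> carries a given point to a
  direction in which \<open>exp g\<close> is large, so the product of the rotated copies of \<open>a\<close> is small
  on the whole circle, against the maximum principle.\<close>

lemma finite_type_mult_exp_at_0:
  assumes a: "finite_type \<rho> a" and b: "finite_type \<rho> b" and \<rho>: "\<rho> < degree g" "degree g > 0"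
    and eq: "\<And>z. a z * exp (poly g z) = b z"
  shows "a 0 = 0"
proof (rule ccontr)
  assume a0: "a 0 \<noteq> 0"
  define d where "d = degree g"
  have d: "d > 0" using \<rho> by (simp add: d_def)
  obtain C where C: "C \<ge> 0" "\<And>z. cmod (a z) \<le> exp (C * (1 + cmod z) powr \<rho>)"
    using finite_typeE[OF a] by blast
  obtain D where D: "D \<ge> 0" "\<And>z. cmod (b z) \<le> exp (D * (1 + cmod z) powr \<rho>)"
    using finite_typeE[OF b] by blast
  define \<alpha> where "\<alpha> = lead_coeff g"
  have \<alpha>: "\<alpha> \<noteq> 0" using d unfolding \<alpha>_def d_def by force
  define h where "h = g - monom \<alpha> d"
  have "degree h \<le> d - 1"
  proof (rule degree_le, safe)
    fix i assume "d - 1 < i"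
    then have "i \<ge> d" by auto
    then show "coeff h i = 0"
      by (cases "i = d") (auto simp: h_def \<alpha>_def d_def coeff_eq_0)
  qed
  then obtain K where K: "K \<ge> 0" "\<And>z. cmod (poly h z) \<le> K * (1 + cmod z) ^ (d - 1)"
    using poly_norm_bound by blast
  have g: "poly g z = \<alpha> * z ^ d + poly h z" for z
    by (simp add: h_def poly_monom)
  \<comment> \<open>Since \<open>\<zeta> ^ d = \<i>\<close>, turning \<open>z\<close> by
    \<open>\<zeta> ^ j\<close> multiplies the leading term \<open>\<alpha> * z ^ d\<close> by
    \<open>\<i> ^ j\<close>.\<close>
  define \<zeta> where "\<zeta> = cis (pi / (2 * d))"
  have \<zeta>d: "\<zeta> ^ d = \<i>"
    using d by (simp add: \<zeta>_def Complex.DeMoivre)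
  have n\<zeta>: "cmod (\<zeta> ^ j) = 1" for j by (simp add: \<zeta>_def norm_power)
  define N where "N = 4 * d"
  define F where "F = (\<lambda>z. \<Prod>j<N. a (z * \<zeta> ^ j))"
  \<comment> \<open>A common exponent below \<open>d\<close> for the growth of \<open>a\<close> and
    \<open>b\<close> and for the lower terms \<open>h\<close> of the polynomial.\<close>
  define s where "s = max \<rho> (real (d - 1))"
  have s: "s < d" "s \<ge> \<rho>" "s \<ge> real (d - 1)" using \<rho> d by (auto simp: s_def d_def)
  \<comment> \<open>The exponent \<open>E\<close> in the bound for \<open>F\<close> collects
    \<open>N\<close> factors of type at most \<open>C + D\<close>, the error \<open>K\<close> from
    \<open>h\<close>, and the gain \<open>cmod \<alpha> / 2 * r ^ d\<close> from the one favourable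
    factor.\<close>
  define M where "M = real N * (C + D) + K"
  define E where "E = (\<lambda>r. M * (1 + r) powr s - cmod \<alpha> / 2 * r ^ d)"
  have F0: "F 0 = a 0 ^ N" by (simp add: F_def)
  have holF: "F holomorphic_on UNIV"
    unfolding F_def
  proof (intro holomorphic_intros)
    fix j
    have "(a \<circ> (\<lambda>z. z * \<zeta> ^ j)) holomorphic_on UNIV"
      by (rule holomorphic_on_compose) (auto intro!: holomorphic_intros finite_type_holomorphic[OF a])
    then show "(\<lambda>z. a (z * \<zeta> ^ j)) holomorphic_on UNIV" by (simp add: o_def)
  qed
  have bound: "cmod (F z) \<le> exp (E (cmod z))" for z
  proof -
    define r where "r = cmod z"
    define X where "X = (1 + r) powr s"
    have X: "(1 + r) powr \<rho> \<le> X" "(1 + r) ^ (d - 1) \<le> X"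
    proof -
      show "(1 + r) powr \<rho> \<le> X" unfolding X_def using s by (intro powr_mono) (auto simp: r_def)
      have "(1 + r) ^ (d - 1) = (1 + r) powr real (d - 1)"
        by (rule powr_realpow[symmetric]) (auto simp: r_def intro: add_pos_nonneg)
      also have "\<dots> \<le> X" unfolding X_def using s by (intro powr_mono) (auto simp: r_def)
      finally show "(1 + r) ^ (d - 1) \<le> X" .
    qed
    have X0: "X \<ge> 0" by (simp add: X_def)
    have small: "cmod (a (z * \<zeta> ^ j)) \<le> exp ((C + D) * X)" for j
    proof -
      have "C * (1 + r) powr \<rho> \<le> (C + D) * X"
        using C(1) D(1) X X0 by (intro mult_mono) auto
      then show ?thesis
        using C(2)[of "z * \<zeta> ^ j"] n\<zeta>[of j] unfolding norm_mult r_def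
        by (simp, meson exp_le_cancel_iff order_trans)
    qed
    obtain i where i: "i < 4" "Re (\<alpha> * z ^ d * \<i> ^ i) \<ge> cmod (\<alpha> * z ^ d) / 2"
      using ex_quarter_turn_Re_ge by blast
    define w where "w = z * \<zeta> ^ i"
    have nw: "cmod w = r" using n\<zeta>[of i] by (simp add: w_def norm_mult r_def)
    have "w ^ d = z ^ d * \<i> ^ i"
      by (simp add: w_def power_mult_distrib power_mult[symmetric] mult.commute flip: \<zeta>d)
    then have Re1: "Re (\<alpha> * w ^ d) \<ge> cmod \<alpha> / 2 * r ^ d"
      using i(2) by (simp add: mult.assoc norm_mult norm_power r_def)
    have "\<bar>Re (poly h w)\<bar> \<le> K * (1 + r) ^ (d - 1)"
      using abs_Re_le_cmod[of "poly h w"] K(2)[of w] unfolding nw by linarith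
    also have "\<dots> \<le> K * X" using K(1) X by (intro mult_left_mono) auto
    finally have Re2: "Re (poly g w) \<ge> cmod \<alpha> / 2 * r ^ d - K * X"
      using Re1 by (simp add: g)
    have "D * (1 + r) powr \<rho> \<le> (C + D) * X"
        using C(1) D(1) X X0 by (intro mult_mono) auto
    then have b': "cmod (b w) \<le> exp ((C + D) * X)"
      using D(2)[of w] unfolding nw by (meson exp_le_cancel_iff order_trans)
    \<comment> \<open>At the favourable point \<open>w\<close> the equation turns the bound for
      \<open>b\<close> into a very small bound for \<open>a\<close>.\<close>
    have "a w = b w * exp (- poly g w)"
      using eq[of w] by (simp add: exp_minus field_simps)
    then have "cmod (a w) = cmod (b w) * exp (- Re (poly g w))" by (simp add: norm_mult)
    also have "\<dots> \<le> exp ((C + D) * X) * exp (K * X - cmod \<alpha> / 2 * r ^ d)"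
      using Re2 by (intro mult_mono b') auto
    finally have aw: "cmod (a w) \<le> exp ((C + D) * X) * exp (K * X - cmod \<alpha> / 2 * r ^ d)" .
    have iN: "i \<in> {..<N}" using i d by (auto simp: N_def)
    have "cmod (F z) = cmod (a w) * (\<Prod>j\<in>{..<N} - {i}. cmod (a (z * \<zeta> ^ j)))"
      unfolding F_def prod_norm[symmetric] w_def using iN by (simp add: prod.remove)
    also have "\<dots> \<le> (exp ((C + D) * X) * exp (K * X - cmod \<alpha> / 2 * r ^ d)) *
        (\<Prod>j\<in>{..<N} - {i}. exp ((C + D) * X))"
      by (intro mult_mono aw prod_mono) (auto intro!: small prod_nonneg)
    also have "(\<Prod>j\<in>{..<N} - {i}. exp ((C + D) * X)) = exp (real (N - 1) * ((C + D) * X))"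
      using iN by (simp add: exp_of_nat_mult del: of_nat_diff)
    also have "exp ((C + D) * X) * exp (K * X - cmod \<alpha> / 2 * r ^ d) * \<dots> = exp (E r)"
    proof -
      have "real (N - 1) = real N - 1" using iN by auto
      then have "(C + D) * X + (K * X - cmod \<alpha> / 2 * r ^ d) + real (N - 1) * ((C + D) * X) = E r"
        unfolding E_def M_def X_def[symmetric] by (simp add: algebra_simps)
      then show ?thesis by (simp only: exp_add[symmetric])
    qed
    finally show ?thesis by (simp add: r_def)
  qed
  have "filterlim E at_bot at_top"
    unfolding E_def using \<alpha> s(1) d by (intro powr_sub_power_at_bot) auto
  then have "eventually (\<lambda>r. E r < ln (cmod (F 0))) at_top"
    by (simp add: filterlim_at_bot_dense)
  then have "eventually (\<lambda>r. E r < ln (cmod (F 0)) \<and> r > 0) at_top"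
    using eventually_gt_at_top by (rule eventually_conj)
  from eventually_happens[OF this] obtain r where r: "E r < ln (cmod (F 0))" "r > 0"
    by auto
  have "cmod (F 0) \<le> exp (E r)"
  proof (rule maximum_modulus_frontier[of F "ball 0 r"])
    show "F holomorphic_on interior (ball 0 r)" using holF holomorphic_on_subset by blast
    show "continuous_on (closure (ball 0 r)) F"
      using holF holomorphic_on_imp_continuous_on continuous_on_subset by blast
    show "cmod (F z) \<le> exp (E r)" if "z \<in> frontier (ball 0 r)" for z
    proof -
      have "cmod z = r" using that r(2) by (simp add: frontier_def)
      then show ?thesis using bound[of z] by simp
    qed
  qed (use r in auto)
  also have "exp (E r) < cmod (F 0)"
    using r a0 F0 by (metis exp_less_cancel_iff exp_ln power_not_zero zero_less_norm_iff)
  finally show False by simp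
qed

text \<open>Translating \<open>z\<close> to the origin preserves finite type and the degree of
  \<open>g\<close>. Below, this two-term statement is what excludes exponentials of too high a
  degree.\<close>

lemma finite_type_mult_exp_eq_0:
  assumes a: "finite_type \<rho> a" and b: "finite_type \<rho> b" and \<rho>: "0 \<le> \<rho>" "\<rho> < degree g"
    and eq: "\<And>z. a z * exp (poly g z) = b z"
  shows "a z = 0"
proof -
  have "degree (g \<circ>\<^sub>p [:z, 1:]) = degree g" by (simp add: degree_pcompose)
  then have "a (0 + z) = 0"
    using assms
    by (intro finite_type_mult_exp_at_0[of \<rho> "\<lambda>w. a (w + z)" "\<lambda>w. b (w + z)" "g \<circ>\<^sub>p [:z, 1:]"]
         finite_type_shift) (auto simp: poly_pcompose add.commute)
  then show ?thesis by simp
qed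

text \<open>Entire functions form an integral domain: two that do not vanish identically have
  isolated zeros, hence are both nonzero on a punctured neighbourhood of 0.\<close>

lemma entire_mult_eq_0:
  assumes "a holomorphic_on UNIV" "b holomorphic_on UNIV" "\<And>z. a z * b z = 0"
  shows "(\<forall>z. a z = 0) \<or> (\<forall>z. b z = 0)"
proof (rule ccontr)
  assume "\<not> ?thesis"
  then obtain x y where xy: "a x \<noteq> 0" "b y \<noteq> 0" by auto
  have "eventually (\<lambda>w. a w \<noteq> 0 \<and> w \<in> UNIV) (at 0)"
    by (rule non_zero_neighbour_alt[where ?\<beta> = x]) (use assms xy in auto)
  moreover have "eventually (\<lambda>w. b w \<noteq> 0 \<and> w \<in> UNIV) (at 0)"
    by (rule non_zero_neighbour_alt[where ?\<beta> = y]) (use assms xy in auto)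
  ultimately have "eventually (\<lambda>w. False) (at (0::complex))"
    by eventually_elim (use assms(3) in auto)
  then show False by simp
qed

text \<open>The differential relation says that the quotient of \<open>a\<close> by
  \<open>b * exp g\<close> has derivative zero. So the quotient is constant on a disc free of zeros
  of \<open>b\<close>, and the identity theorem carries the relation to the whole plane.\<close>

lemma logderiv_eq_imp_exp_multiple:
  assumes a: "a holomorphic_on UNIV" and b: "b holomorphic_on UNIV"
    and eq: "\<And>z. deriv a z * b z = a z * (deriv b z + poly (pderiv g) z * b z)"
    and nz: "\<exists>z. b z \<noteq> 0"
  obtains K where "\<And>z. a z = K * b z * exp (poly g z)"
proof -
  obtain z0 where z0: "b z0 \<noteq> 0" using nz by blast
  have "open (- b -` {0})"
    using holomorphic_on_imp_continuous_on[OF b]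
    by (metis (no_types, lifting) closed_singleton continuous_closed_vimage continuous_on_eq_continuous_at open_Compl open_UNIV UNIV_I)
  then obtain e where e: "e > 0" "\<And>z. z \<in> ball z0 e \<Longrightarrow> b z \<noteq> 0"
    using z0 unfolding open_contains_ball by blast
  define q where "q = (\<lambda>z. a z / b z * exp (- poly g z))"
  have da: "(a has_field_derivative deriv a z) (at z)" for z
    using a holomorphic_derivI by blast
  have db: "(b has_field_derivative deriv b z) (at z)" for z
    using b holomorphic_derivI by blast
  have "(q has_field_derivative 0) (at z within ball z0 e)" if "z \<in> ball z0 e" for z
  proof -
    have bz: "b z \<noteq> 0" using e that by blast
    have "(q has_field_derivative ((deriv a z * b z - a z * deriv b z) / (b z * b z) * exp (- poly g z)
        + (exp (- poly g z) * - poly (pderiv g) z) * (a z / b z))) (at z)"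
      unfolding q_def by (intro DERIV_mult DERIV_divide da db bz)
        (auto intro!: derivative_eq_intros)
    also have "((deriv a z * b z - a z * deriv b z) / (b z * b z) * exp (- poly g z)
        + (exp (- poly g z) * - poly (pderiv g) z) * (a z / b z)) = 0"
      unfolding eq using bz by (simp add: field_simps)
    finally show ?thesis using has_field_derivative_at_within by blast
  qed
  then obtain K where K: "\<And>z. z \<in> ball z0 e \<Longrightarrow> q z = K"
    using has_field_derivative_zero_constant[of "ball z0 e" q] by blast
  have "a z = K * b z * exp (poly g z)" for z
  proof (rule analytic_continuation_open[of "ball z0 e" UNIV a "\<lambda>z. K * b z * exp (poly g z)"])
    show "a z = K * b z * exp (poly g z)" if "z \<in> ball z0 e" for z
      using K[OF that] e(2)[OF that] by (simp add: q_def exp_minus field_simps)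
  qed (use a b e in \<open>auto intro!: holomorphic_intros\<close>)
  then show ?thesis by (rule that)
qed

text \<open>Differentiating the relation and eliminating the term without exponential leaves a
  two-term relation \<open>A * exp (g - h) = B\<close>, which forces \<open>A = 0\<close>. Up to
  sign and the factor \<open>exp g\<close>, \<open>A\<close> is the Wronskian of \<open>a\<close>
  and \<open>b * exp g\<close>, so these two are proportional.\<close>

lemma borel_three_term:
  assumes a: "finite_type \<rho> a" and b: "finite_type \<rho> b" and c: "finite_type \<rho> c"
    and \<rho>: "0 < \<rho>" "\<rho> < degree g" "\<rho> < degree h" "\<rho> < degree (g - h)"
    and eq: "\<And>z. a z + b z * exp (poly g z) + c z * exp (poly h z) = 0"
  shows "(\<forall>z. a z = 0) \<or> (\<forall>z. b z = 0)"
proof (rule ccontr)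
  assume "\<not> ?thesis"
  then have nz: "\<exists>z. a z \<noteq> 0" "\<exists>z. b z \<noteq> 0" by auto
  have da: "(a has_field_derivative deriv a z) (at z)" for z
    using finite_type_holomorphic[OF a] holomorphic_derivI by blast
  have db: "(b has_field_derivative deriv b z) (at z)" for z
    using finite_type_holomorphic[OF b] holomorphic_derivI by blast
  have dc: "(c has_field_derivative deriv c z) (at z)" for z
    using finite_type_holomorphic[OF c] holomorphic_derivI by blast
  have eq': "deriv a z + (deriv b z + poly (pderiv g) z * b z) * exp (poly g z) +
      (deriv c z + poly (pderiv h) z * c z) * exp (poly h z) = 0" for z
  proof -
    have "((\<lambda>z. a z + b z * exp (poly g z) + c z * exp (poly h z)) has_field_derivative
       (deriv a z + (deriv b z + poly (pderiv g) z * b z) * exp (poly g z) +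
      (deriv c z + poly (pderiv h) z * c z) * exp (poly h z))) (at z)"
      by (rule derivative_eq_intros da db dc poly_DERIV refl)+ (simp add: algebra_simps)
    moreover have "((\<lambda>z. a z + b z * exp (poly g z) + c z * exp (poly h z)) has_field_derivative 0) (at z)"
      by (simp add: eq)
    ultimately show ?thesis using DERIV_unique by blast
  qed
  define A where "A = (\<lambda>z. deriv a z * b z - a z * (deriv b z + poly (pderiv g) z * b z))"
  define B where "B = (\<lambda>z. a z * (deriv c z + poly (pderiv h) z * c z) - deriv a z * c z)"
  have ft: "finite_type \<rho> A" "finite_type \<rho> B"
    unfolding A_def B_def using \<rho> a b c
    by (intro finite_type_diff finite_type_mult finite_type_add finite_type_deriv finite_type_poly; simp)+
  have "A z * exp (poly (g - h) z) = B z" for z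
  proof -
    have "A z * exp (poly g z) - B z * exp (poly h z) =
       deriv a z * (a z + b z * exp (poly g z) + c z * exp (poly h z)) -
       a z * (deriv a z + (deriv b z + poly (pderiv g) z * b z) * exp (poly g z) +
      (deriv c z + poly (pderiv h) z * c z) * exp (poly h z))"
      by (simp add: A_def B_def algebra_simps)
    also have "\<dots> = 0" by (simp only: eq eq' mult_zero_right diff_self)
    finally show ?thesis by (simp add: exp_diff field_simps)
  qed
  then have "A z = 0" for z
    using \<rho> ft by (intro finite_type_mult_exp_eq_0[of \<rho> A B "g - h"]) auto
  then obtain K where K: "\<And>z. a z = K * b z * exp (poly g z)"
    using logderiv_eq_imp_exp_multiple[of a b g] nz finite_type_holomorphic a b
    by (auto simp: A_def)
  \<comment> \<open>The proportionality is again a two-term relation; it leaves \<open>K = 0\<close>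
    or \<open>b = 0\<close>, and either contradicts \<open>nz\<close>.\<close>
  have "(\<lambda>z. K * b z) z = 0" for z
    using \<rho> a b K by (intro finite_type_mult_exp_eq_0[of \<rho> "\<lambda>z. K * b z" a g]) auto
  then show False using nz K by auto
qed

section \<open>Means over circles\<close>

text \<open>Cauchy's formula for derivatives, written out in the angle: the Fourier coefficient of
  index \<open>k\<close> on the circle is the Taylor coefficient times \<open>r ^ k\<close>.\<close>

lemma circle_coefficient_has_integral:
  fixes G :: "complex \<Rightarrow> complex" and r :: real
  assumes "G holomorphic_on UNIV" "r > 0"
  shows "((\<lambda>t. G (of_real r * cis t) * cis (- (real k * t))) has_integral
           2 * pi * ((deriv ^^ k) G 0 / fact k * of_real r ^ k)) {0..2 * pi}"
proof -
  have "((\<lambda>u. G u / (u - 0) ^ Suc k) has_contour_integral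
      (2 * pi * \<i>) / fact k * (deriv ^^ k) G 0) (circlepath 0 r)"
    using assms by (intro Cauchy_has_contour_integral_higher_derivative_circlepath)
      (auto intro: holomorphic_on_subset holomorphic_on_imp_continuous_on continuous_on_subset)
  then have "((\<lambda>t. G (of_real r * cis t) / (of_real r * cis t) ^ Suc k * r * \<i> * cis t) has_integral
      (2 * pi * \<i>) / fact k * (deriv ^^ k) G 0) {0..2 * pi}"
    unfolding circlepath_def by (subst (asm) has_contour_integral_part_circlepath_iff) auto
  from has_integral_mult_right[OF this, of "of_real r ^ k / \<i>"]
  have "((\<lambda>t. of_real r ^ k / \<i> * (G (of_real r * cis t) / (of_real r * cis t) ^ Suc k * r * \<i> * cis t))
      has_integral 2 * pi * ((deriv ^^ k) G 0 / fact k * of_real r ^ k)) {0..2 * pi}"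
    by (simp add: field_simps)
  moreover have "of_real r ^ k / \<i> * (G (of_real r * cis t) / (of_real r * cis t) ^ Suc k * r * \<i> * cis t) =
       G (of_real r * cis t) * cis (- (real k * t))" for t
  proof -
    have "inverse (cis t ^ k) = cis (- (real k * t))" by (simp add: Complex.DeMoivre)
    then show ?thesis
      using assms(2) by (simp add: field_simps power_mult_distrib)
  qed
  ultimately show ?thesis by simp
qed

lemma circle_mean_has_integral:
  fixes G :: "complex \<Rightarrow> complex" and r :: real
  assumes "G holomorphic_on UNIV" "r > 0"
  shows "((\<lambda>t. G (of_real r * cis t)) has_integral 2 * pi * G 0) {0..2 * pi}"
  using circle_coefficient_has_integral[OF assms, of 0] by simp

text \<open>For \<open>n > 0\<close> the conjugate of \<open>g\<close> has vanishing Fourier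
  coefficient of index \<open>n\<close>, so \<open>2 * Re g\<close> has the same coefficient as
  \<open>g\<close>.\<close>

lemma norm_coefficient_le_integral_abs_Re:
  fixes g :: "complex \<Rightarrow> complex" and r :: real
  assumes g: "g holomorphic_on UNIV" and r: "r > 0" and n: "n > 0"
  shows "pi * cmod ((deriv ^^ n) g 0 / fact n) * r ^ n \<le>
           integral {0..2 * pi} (\<lambda>t. \<bar>Re (g (of_real r * cis t))\<bar>)"
proof -
  define b where "b = (deriv ^^ n) g 0 / fact n * of_real r ^ n"
  have 1: "((\<lambda>t. g (of_real r * cis t) * cis (- (real n * t))) has_integral 2 * pi * b) {0..2 * pi}"
    unfolding b_def by (rule circle_coefficient_has_integral) (use g r in auto)
  \<comment> \<open>The function \<open>z ^ n * g z\<close> vanishes at 0, so its mean is zero;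
    conjugation turns this into the claim about the conjugate of \<open>g\<close>.\<close>
  have "((\<lambda>t. (of_real r * cis t) ^ n * g (of_real r * cis t)) has_integral 2 * pi * (0 ^ n * g 0)) {0..2 * pi}"
    by (rule circle_mean_has_integral) (use g r in \<open>auto intro!: holomorphic_intros\<close>)
  then have "((\<lambda>t. (of_real r * cis t) ^ n * g (of_real r * cis t)) has_integral 0) {0..2 * pi}"
    using n by (simp add: zero_power)
  from has_integral_mult_right[OF this, of "1 / of_real r ^ n"]
  have "((\<lambda>t. cis t ^ n * g (of_real r * cis t)) has_integral 0) {0..2 * pi}"
    using r by (simp add: power_mult_distrib field_simps)
  from has_integral_linear[OF this bounded_linear_cnj]
  have "((\<lambda>t. cnj (cis t ^ n * g (of_real r * cis t))) has_integral cnj 0) {0..2 * pi}"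
    by (simp only: o_def)
  then have "((\<lambda>t. cnj (g (of_real r * cis t)) * cis (- (real n * t))) has_integral 0) {0..2 * pi}"
    by (simp add: Complex.DeMoivre cis_cnj mult.commute)
  from has_integral_add[OF 1 this]
  have "((\<lambda>t. of_real (2 * Re (g (of_real r * cis t))) * cis (- (real n * t))) has_integral 2 * pi * b) {0..2 * pi}"
    by (simp add: distrib_right[symmetric] complex_add_cnj)
  from has_integral_mult_right[OF this, of "1 / 2"]
  have 2: "((\<lambda>t. of_real (Re (g (of_real r * cis t))) * cis (- (real n * t))) has_integral pi * b) {0..2 * pi}"
    by (simp add: field_simps)
  have cont: "continuous_on {0..2 * pi} (\<lambda>t. \<bar>Re (g (of_real r * cis t))\<bar>)"
    by (intro continuous_intros continuous_on_compose2[OF holomorphic_on_imp_continuous_on[OF g]]) auto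
  have "cmod (integral {0..2 * pi} (\<lambda>t. of_real (Re (g (of_real r * cis t))) * cis (- (real n * t)))) \<le>
      integral {0..2 * pi} (\<lambda>t. \<bar>Re (g (of_real r * cis t))\<bar>)"
    using 2 cont by (intro integral_norm_bound_integral)
      (auto simp: norm_mult has_integral_integrable intro: integrable_continuous_real)
  also have "integral {0..2 * pi} (\<lambda>t. of_real (Re (g (of_real r * cis t))) * cis (- (real n * t))) = pi * b"
    using 2 by (rule integral_unique)
  finally show ?thesis using r by (simp add: b_def norm_mult norm_power norm_divide mult.assoc)
qed

text \<open>The Riemann sums of \<open>ln \<bar>P\<bar>\<close> on the circle are values of \<open>ln \<bar>F\<bar>\<close> for the product \<open>F\<close> of
  the rotated copies of \<open>P\<close>, to which the maximum principle applies.\<close>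

lemma ln_norm_le_circle_mean:
  fixes P :: "complex \<Rightarrow> complex" and r :: real
  assumes P: "P holomorphic_on UNIV" and r: "r > 0" and nz: "\<And>z. cmod z = r \<Longrightarrow> P z \<noteq> 0"
    and P0: "P 0 \<noteq> 0"
  shows "2 * pi * ln (cmod (P 0)) \<le> integral {0..2 * pi} (\<lambda>t. ln (cmod (P (of_real r * cis t))))"
proof (rule field_le_epsilon)
  fix \<epsilon>' :: real assume "\<epsilon>' > 0"
  define \<epsilon> where "\<epsilon> = \<epsilon>' / (2 * pi)"
  have \<epsilon>: "\<epsilon> > 0" using \<open>\<epsilon>' > 0\<close> by (simp add: \<epsilon>_def)
  define \<phi> where "\<phi> = (\<lambda>t. ln (cmod (P (of_real r * cis t))))"
  have nz': "P (of_real r * cis t) \<noteq> 0" for t using r by (intro nz) (simp add: norm_mult)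
  have cont: "continuous_on A \<phi>" for A
    unfolding \<phi>_def
    by (intro continuous_intros continuous_on_compose2[OF holomorphic_on_imp_continuous_on[OF P]]) (auto simp: nz')
  have int: "\<phi> integrable_on {a..b}" for a b
    using cont by (rule integrable_continuous_real)
  have "uniformly_continuous_on {0..2 * pi} \<phi>"
    by (rule compact_uniformly_continuous) (auto intro: cont)
  then obtain \<delta> where \<delta>: "\<delta> > 0"
      "\<And>x x'. x \<in> {0..2 * pi} \<Longrightarrow> x' \<in> {0..2 * pi} \<Longrightarrow> dist x' x < \<delta> \<Longrightarrow> dist (\<phi> x') (\<phi> x) < \<epsilon>"
    using \<epsilon> by (rule uniformly_continuous_onE) blast
  obtain N :: nat where N: "real N > 2 * pi / \<delta>" using reals_Archimedean2 by blast
  have N0: "N > 0" 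
    using N \<delta> pi_gt_zero by (metis divide_nonneg_pos gr0I linorder_not_less mult_nonneg_nonneg of_nat_0 order_less_le zero_le_numeral)
  define h where "h = 2 * pi / N"
  have h: "h > 0" "h < \<delta>" "N * h = 2 * pi"
    using N N0 \<delta> by (auto simp: h_def field_simps)
  define F where "F = (\<lambda>z. \<Prod>j<N. P (z * cis (j * h)))"
  \<comment> \<open>One rotation by \<open>h\<close> shifts the index of the factors. The end
    factors agree because \<open>N * h\<close> is a full turn, and being nonzero they
    cancel.\<close>
  have F_rot1: "F (z * cis h) = F z" if z: "cmod z = r" for z
  proof -
    define p where "p = (\<lambda>j::nat. P (z * cis (j * h)))"
    have "p N = p 0" by (simp add: p_def h(3))
    moreover have "p 0 \<noteq> 0" using nz[OF z] by (simp add: p_def)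
    moreover have "p 0 * (\<Prod>j<N. p (Suc j)) = (\<Prod>j<N. p j) * p N"
      using prod.lessThan_Suc_shift[of p N] prod.lessThan_Suc[of p N] by simp
    ultimately have "(\<Prod>j<N. p (Suc j)) = (\<Prod>j<N. p j)" by simp
    then show ?thesis
      by (simp add: F_def p_def algebra_simps cis_mult)
  qed
  have F_rot: "F (z * cis (k * h)) = F z" if z: "cmod z = r" for z and k :: nat
  proof (induction k)
    case (Suc k)
    have "z * cis (real (Suc k) * h) = z * cis (k * h) * cis h"
      by (simp add: cis_mult algebra_simps)
    then have "F (z * cis (real (Suc k) * h)) = F (z * cis (k * h) * cis h)" by (rule arg_cong)
    also have "\<dots> = F (z * cis (k * h))" by (rule F_rot1) (use z in \<open>simp add: norm_mult\<close>)
    finally show ?case using Suc by simp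
  qed simp
  define I where "I = integral {0..2 * pi} \<phi>"
  \<comment> \<open>Each tag \<open>\<theta> + j * h\<close> lies in a subinterval shorter than
    \<open>\<delta>\<close>, so the Riemann sum exceeds the integral by at most
    \<open>\<epsilon>\<close> per unit of angle, which makes \<open>\<epsilon>'\<close> over the
    full circle.\<close>
  have riemann: "(\<Sum>j<n. h * \<phi> (\<theta> + j * h)) \<le> integral {0..n * h} \<phi> + n * h * \<epsilon>"
    if \<theta>: "\<theta> \<in> {0..h}" and "n \<le> N" for \<theta> :: real and n :: nat
    using \<open>n \<le> N\<close>
  proof (induction n)
    case (Suc n)
    have le: "real (Suc n) * h \<le> 2 * pi"
      unfolding h(3)[symmetric] using Suc.prems h by (intro mult_right_mono) auto
    have "h * \<phi> (\<theta> + n * h) = integral {n * h..Suc n * h} (\<lambda>t. \<phi> (\<theta> + n * h))"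
      using h by (simp add: algebra_simps)
    also have "\<dots> \<le> integral {n * h..Suc n * h} (\<lambda>t. \<phi> t + \<epsilon>)"
    proof (rule integral_le)
      fix t assume t: "t \<in> {n * h..Suc n * h}"
      have "\<theta> + n * h \<in> {0..2 * pi}" "t \<in> {0..2 * pi}" "dist (\<theta> + n * h) t < \<delta> \<or> \<theta> + n * h = t"
        using \<theta> t le h by (auto simp: dist_real_def algebra_simps abs_if intro: order_trans[rotated])
      then have "dist (\<phi> (\<theta> + n * h)) (\<phi> t) < \<epsilon>"
        using \<delta>(2)[of t "\<theta> + n * h"] \<epsilon> by auto
      then show "\<phi> (\<theta> + n * h) \<le> \<phi> t + \<epsilon>" by (simp add: dist_real_def abs_less_iff)
    qed (auto intro!: integrable_add int)
    also have "\<dots> = integral {n * h..Suc n * h} \<phi> + h * \<epsilon>"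
      using h by (subst integral_add) (auto intro: int simp: algebra_simps)
    finally have "(\<Sum>j<Suc n. h * \<phi> (\<theta> + j * h)) \<le>
        (integral {0..n * h} \<phi> + integral {n * h..Suc n * h} \<phi>) + (n * h * \<epsilon> + h * \<epsilon>)"
      using Suc by simp
    also have "integral {0..n * h} \<phi> + integral {n * h..Suc n * h} \<phi> = integral {0..Suc n * h} \<phi>"
      using h by (intro Henstock_Kurzweil_Integration.integral_combine int) (auto simp: algebra_simps)
    finally show ?case by (simp add: algebra_simps)
  qed simp
  have boundF: "cmod (F z) \<le> exp ((I + \<epsilon>') / h)" if z: "cmod z = r" for z
  proof -
    define t where "t = Arg2pi z"
    have t: "0 \<le> t" "t < 2 * pi" "z = of_real r * cis t"
      using Arg2pi[of z] z by (auto simp: t_def cis_conv_exp mult.commute is_Arg_def)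
    \<comment> \<open>Removing \<open>k\<close> whole steps brings the angle into
      \<open>{0..h}\<close> without changing \<open>F\<close>; then \<open>h\<close> times the
      logarithm of \<open>cmod (F z)\<close> is one of the Riemann sums above.\<close>
    define k where "k = nat \<lfloor>t / h\<rfloor>"
    have k: "real k \<le> t / h" "t / h < real k + 1"
      using t(1) h by (auto simp: k_def)
    define \<theta> where "\<theta> = t - k * h"
    have \<theta>: "\<theta> \<in> {0..h}" using k h by (auto simp: \<theta>_def field_simps)
    have "z = of_real r * cis \<theta> * cis (k * h)"
      by (simp add: t(3) \<theta>_def cis_mult mult.assoc)
    then have "F z = F (of_real r * cis \<theta>)"
      using F_rot[of "of_real r * cis \<theta>" k] r by (simp add: norm_mult)
    also have "cmod \<dots> = (\<Prod>j<N. cmod (P (of_real r * cis (\<theta> + j * h))))"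
      by (simp add: F_def prod_norm[symmetric] mult.assoc cis_mult)
    also have "\<dots> = exp (\<Sum>j<N. \<phi> (\<theta> + j * h))"
      by (simp add: exp_sum \<phi>_def nz')
    also have "\<dots> \<le> exp ((I + \<epsilon>') / h)"
    proof -
      have "h * (\<Sum>j<N. \<phi> (\<theta> + j * h)) \<le> I + \<epsilon>'"
        using riemann[OF \<theta> order_refl] unfolding h(3) by (simp add: I_def \<epsilon>_def sum_distrib_left)
      then show ?thesis using h(1) by (simp add: field_simps)
    qed
    finally show ?thesis .
  qed
  have holF: "F holomorphic_on UNIV"
    unfolding F_def
  proof (intro holomorphic_intros)
    fix j :: nat
    have "(P \<circ> (\<lambda>z. z * cis (j * h))) holomorphic_on UNIV"
      by (rule holomorphic_on_compose) (auto intro!: holomorphic_intros holomorphic_on_subset[OF P])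
    then show "(\<lambda>z. P (z * cis (j * h))) holomorphic_on UNIV" by (simp add: o_def)
  qed
  have "cmod (F 0) \<le> exp ((I + \<epsilon>') / h)"
  proof (rule maximum_modulus_frontier[of F "ball 0 r"])
    show "F holomorphic_on interior (ball 0 r)" using holF holomorphic_on_subset by blast
    show "continuous_on (closure (ball 0 r)) F"
      using holF holomorphic_on_imp_continuous_on continuous_on_subset by blast
    show "cmod (F z) \<le> exp ((I + \<epsilon>') / h)" if "z \<in> frontier (ball 0 r)" for z
      using that r by (intro boundF) (simp add: frontier_def)
  qed (use r in auto)
  also have "cmod (F 0) = exp (N * ln (cmod (P 0)))"
    using P0 by (simp add: F_def norm_power exp_of_nat_mult)
  finally have "N * ln (cmod (P 0)) \<le> (I + \<epsilon>') / h" by simp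
  then have "N * h * ln (cmod (P 0)) \<le> I + \<epsilon>'" using h(1) by (simp add: field_simps)
  then show "2 * pi * ln (cmod (P 0)) \<le> integral {0..2 * pi} (\<lambda>t. ln (cmod (P (of_real r * cis t)))) + \<epsilon>'"
    by (simp add: h(3) I_def \<phi>_def)
qed

section \<open>Nevanlinna functionals of entire functions\<close>

lemma log_plus_nonneg [simp]: "0 \<le> log_plus x"
  by (simp add: log_plus_def)

lemma exp_log_plus: "exp (log_plus x) = max 1 x"
  unfolding log_plus_def by (rule exp_ln) auto

lemma log_plus_le_iff: "log_plus x \<le> B \<longleftrightarrow> 0 \<le> B \<and> x \<le> exp B"
proof -
  have "log_plus x \<le> B \<longleftrightarrow> exp (log_plus x) \<le> exp B" by simp
  also have "\<dots> \<longleftrightarrow> 0 \<le> B \<and> x \<le> exp B" unfolding exp_log_plus by auto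
  finally show ?thesis .
qed

lemma ln_le_log_plus: "x > 0 \<Longrightarrow> ln x \<le> log_plus x"
  unfolding log_plus_def by (subst ln_le_cancel_iff) auto

lemma eventually_le_powr_of_Limsup_log_plus:
  assumes "Limsup at_top (\<lambda>r::real. ereal (log_plus (T r) / ln r)) < ereal s"
  shows "eventually (\<lambda>r. T r \<le> r powr s) at_top"
  using Limsup_lessD[OF assms] eventually_gt_at_top[of 1]
proof eventually_elim
  case (elim r)
  then have "log_plus (T r) \<le> s * ln r" by (simp add: field_simps)
  then have "T r \<le> exp (s * ln r)" by (simp add: log_plus_le_iff)
  then show ?case using elim by (simp add: powr_def)
qed

lemma Limsup_log_plus_le:
  assumes "eventually (\<lambda>r. T r \<le> C * r powr s) at_top" "s \<ge> 0"
  shows "Limsup at_top (\<lambda>r::real. ereal (log_plus (T r) / ln r)) \<le> ereal s"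
proof -
  \<comment> \<open>With \<open>D \<ge> 1\<close> the logarithm \<open>ln D\<close> is nonnegative,
    as a bound for \<open>log_plus\<close> has to be; after division by \<open>ln r\<close> it
    disappears in the limit.\<close>
  define D where "D = max 1 C"
  have "eventually (\<lambda>r. ereal (log_plus (T r) / ln r) \<le> ereal (ln D / ln r + s)) at_top"
    using assms(1) eventually_gt_at_top[of 1]
  proof eventually_elim
    case (elim r)
    have "T r \<le> D * r powr s" using elim(1) by (rule order_trans) (auto intro!: mult_right_mono simp: D_def)
    also have "\<dots> = exp (ln D + s * ln r)" using elim by (simp add: exp_add D_def powr_def)
    finally have "log_plus (T r) \<le> ln D + s * ln r"
      unfolding log_plus_le_iff using assms(2) elim by (simp add: D_def)
    then show ?case using elim by (simp add: field_simps)
  qed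
  then have "Limsup at_top (\<lambda>r::real. ereal (log_plus (T r) / ln r)) \<le>
      Limsup at_top (\<lambda>r::real. ereal (ln D / ln r + s))"
    by (rule Limsup_mono)
  also have "\<dots> = ereal s"
  proof (rule lim_imp_Limsup)
    have "((\<lambda>r::real. ln D / ln r + s) \<longlongrightarrow> s) at_top" by real_asymp
    then show "((\<lambda>r::real. ereal (ln D / ln r + s)) \<longlongrightarrow> ereal s) at_top" by simp
  qed simp
  finally show ?thesis .
qed

lemma Limsup_log_plus_nonneg: "0 \<le> Limsup at_top (\<lambda>r::real. ereal (log_plus (T r) / ln r))"
proof -
  have "eventually (\<lambda>r::real. 0 \<le> ereal (log_plus (T r) / ln r)) at_top"
    using eventually_gt_at_top[of 1] by eventually_elim auto
  then have "0 \<le> Liminf at_top (\<lambda>r::real. ereal (log_plus (T r) / ln r))" by (rule Liminf_bounded)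
  also have "\<dots> \<le> Limsup at_top (\<lambda>r::real. ereal (log_plus (T r) / ln r))" by (rule Liminf_le_Limsup) simp
  finally show ?thesis .
qed

section \<open>Characteristic and order of entire functions\<close>

lemma nevanlinna_T_entire:
  assumes "f holomorphic_on UNIV"
  shows "nevanlinna_T r f = proximity r f"
proof -
  have "\<not> is_pole f z" for z using assms by (intro not_is_pole_holomorphic[of UNIV]) auto
  then have "pole_count t f = 0" for t by (simp add: pole_count_def)
  then show ?thesis by (simp add: nevanlinna_T_def counting_N_def)
qed

lemma continuous_on_log_plus [continuous_intros]:
  "continuous_on A g \<Longrightarrow> continuous_on A (\<lambda>x. log_plus (g x))"
  unfolding log_plus_def by (intro continuous_intros) (auto simp: max_def)

lemma proximity_integrable:
  assumes "f holomorphic_on UNIV"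
  shows "(\<lambda>t. log_plus (cmod (f (of_real r * cis t)))) integrable_on {0..2 * pi}"
  by (intro integrable_continuous_real continuous_intros
      continuous_on_compose2[OF holomorphic_on_imp_continuous_on[OF assms]]) auto

lemma proximity_le:
  assumes f: "f holomorphic_on UNIV" and B: "0 \<le> B" "\<And>z. cmod z = \<bar>r\<bar> \<Longrightarrow> cmod (f z) \<le> exp B"
  shows "proximity r f \<le> B"
proof -
  have "integral {0..2 * pi} (\<lambda>t. log_plus (cmod (f (of_real r * cis t)))) \<le> integral {0..2 * pi} (\<lambda>t. B)"
    by (rule integral_le) (use B in \<open>auto intro!: proximity_integrable[OF f] simp: log_plus_le_iff norm_mult\<close>)
  then show ?thesis by (simp add: proximity_def field_simps)
qed

text \<open>This upper bound later forces the degree of the exponent in Hadamard's factorization up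
  to the order of \<open>f\<close>.\<close>

lemma growth_order_finite_type:
  assumes "finite_type s f" "s \<ge> 0"
  shows "growth_order f \<le> ereal s"
proof -
  have f: "f holomorphic_on UNIV" using assms finite_type_holomorphic by blast
  obtain C where C: "C \<ge> 0" "\<And>z. cmod (f z) \<le> exp (C * (1 + cmod z) powr s)"
    using finite_typeE[OF assms(1)] by blast
  have "eventually (\<lambda>r. nevanlinna_T r f \<le> (C * 2 powr s) * r powr s) at_top"
    using eventually_ge_at_top[of 1]
  proof eventually_elim
    case (elim r)
    have "proximity r f \<le> C * (1 + r) powr s"
      using C elim by (intro proximity_le[OF f]) (auto intro: order_trans[OF C(2)])
    also have "\<dots> \<le> C * (2 * r) powr s"
      using C(1) elim assms(2) by (intro mult_left_mono powr_mono2) auto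
    finally show ?case using elim by (simp add: nevanlinna_T_entire[OF f] powr_mult)
  qed
  then show ?thesis unfolding growth_order_def using assms(2) by (rule Limsup_log_plus_le)
qed

lemma growth_order_less_imp_proximity_le:
  assumes "f holomorphic_on UNIV" "growth_order f < ereal s"
  shows "eventually (\<lambda>r. proximity r f \<le> r powr s) at_top"
  using eventually_le_powr_of_Limsup_log_plus[of "\<lambda>r. nevanlinna_T r f" s] assms
  by (simp add: growth_order_def nevanlinna_T_entire)

section \<open>Zeros of an entire function and their counting function\<close>

context
  fixes f :: "complex \<Rightarrow> complex"
  assumes f: "f holomorphic_on UNIV" and nz: "\<exists>z. f z \<noteq> 0"
begin

lemma entire_eventually_nonzero: "eventually (\<lambda>w. f w \<noteq> 0) (at z)"
proof -
  obtain \<beta> where "f \<beta> \<noteq> 0" using nz by blast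
  then have "eventually (\<lambda>w. f w \<noteq> 0 \<and> w \<in> UNIV) (at z)"
    using f by (intro non_zero_neighbour_alt[where ?\<beta> = \<beta>]) auto
  then show ?thesis by simp
qed

lemma entire_analytic_at: "f analytic_on {z}"
  using f by (simp add: analytic_on_holomorphic) blast

lemma entire_zorder_pos_iff: "zorder f z > 0 \<longleftrightarrow> f z = 0"
  by (intro zorder_pos_iff' entire_analytic_at eventually_frequently entire_eventually_nonzero) simp

lemma entire_zorder_nonneg: "zorder f z \<ge> 0"
  by (intro zorder_ge_0 entire_analytic_at eventually_frequently entire_eventually_nonzero) simp

lemma entire_zeros_no_limpt: "\<not> z islimpt {w. f w = 0}"
  using entire_eventually_nonzero[of z] by (auto simp: islimpt_iff_eventually)

lemma entire_zeros_finite: "finite ({w. f w = 0} \<inter> cball 0 R)"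
proof (rule ccontr)
  assume "infinite ({w. f w = 0} \<inter> cball 0 R)"
  then have "\<exists>z\<in>cball 0 R. z islimpt ({w. f w = 0} \<inter> cball 0 R)"
    by (intro Heine_Borel_imp_Bolzano_Weierstrass) auto
  then show False using entire_zeros_no_limpt islimpt_subset by blast
qed

text \<open>Zeros are isolated, and being a pole concerns only a punctured neighbourhood, so the
  value 0 that \<open>1 / f z\<close> takes at a zero does no harm.\<close>

lemma is_pole_reciprocal_iff: "is_pole (\<lambda>z. 1 / f z) z \<longleftrightarrow> f z = 0"
proof -
  have "is_pole (\<lambda>z. 1 / f z) z \<longleftrightarrow> isolated_zero f z"
    using is_pole_inverse_iff[of f z] by (simp add: inverse_eq_divide)
  also have "\<dots> \<longleftrightarrow> f z = 0"
    using isolated_zero_analytic_iff[OF entire_analytic_at] entire_eventually_nonzero by blast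
  finally show ?thesis .
qed

lemma zorder_reciprocal: "zorder (\<lambda>z. 1 / f z) z = - zorder f z"
proof -
  have "frequently (\<lambda>w. f w \<noteq> 0) (at z)"
    by (intro eventually_frequently entire_eventually_nonzero) simp
  moreover have "f meromorphic_on {z}"
    by (intro analytic_on_imp_meromorphic_on entire_analytic_at)
  ultimately show ?thesis
    using zorder_divide[of "\<lambda>_. 1" z f] by (simp add: analytic_on_imp_meromorphic_on)
qed

lemma pole_count_reciprocal:
  "pole_count t (\<lambda>z. 1 / f z) = (\<Sum>z\<in>{z. f z = 0 \<and> cmod z \<le> t}. nat (zorder f z))"
  unfolding pole_count_def is_pole_reciprocal_iff zorder_reciprocal by (simp add: conj_commute)

lemma finite_zeros_le: "finite {z. z \<noteq> 0 \<and> f z = 0 \<and> cmod z \<le> R}"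
  by (rule finite_subset[OF _ entire_zeros_finite[of R]]) auto

text \<open>A zero \<open>z \<noteq> 0\<close> enters the count, with its multiplicity, from radius
  \<open>cmod z\<close> on, and integrating \<open>1 / t\<close> from there to \<open>R\<close>
  gives the difference of logarithms.\<close>

lemma counting_N_reciprocal:
  assumes "R \<ge> 0"
  shows "counting_N R (\<lambda>z. 1 / f z) =
    (\<Sum>z\<in>{z. z \<noteq> 0 \<and> f z = 0 \<and> cmod z \<le> R}. real (nat (zorder f z)) * (ln R - ln (cmod z)))
    + real (pole_count 0 (\<lambda>z. 1 / f z)) * ln R"
proof -
  define Z where "Z = {z. z \<noteq> 0 \<and> f z = 0 \<and> cmod z \<le> R}"
  define m where "m = (\<lambda>z. real (nat (zorder f z)))"
  define n where "n = (\<lambda>t. real (pole_count t (\<lambda>z. 1 / f z)))"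
  have finZ: "finite Z" unfolding Z_def by (rule finite_zeros_le)
  \<comment> \<open>At \<open>t = 0\<close> both sides are 0: by division by zero on the left, by
    \<open>cmod z > 0\<close> on the right.\<close>
  have n_eq: "(n t - n 0) / t = (\<Sum>z\<in>Z. m z * (if t \<in> {cmod z..R} then 1 / t else 0))"
    if t: "t \<in> {0..R}" for t
  proof -
    have fin0: "finite {z. f z = 0 \<and> cmod z \<le> t}" 
      by (rule finite_subset[OF _ entire_zeros_finite[of t]]) auto
    have "n t - n 0 = (\<Sum>z\<in>{z. f z = 0 \<and> cmod z \<le> t}. m z) - (\<Sum>z\<in>{z. f z = 0 \<and> cmod z \<le> 0}. m z)"
      by (simp add: n_def m_def pole_count_reciprocal)
    also have "\<dots> = (\<Sum>z\<in>{z. f z = 0 \<and> cmod z \<le> t} - {z. f z = 0 \<and> cmod z \<le> 0}. m z)"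
      using fin0 t by (intro sum_diff[symmetric]) auto
    also have "{z. f z = 0 \<and> cmod z \<le> t} - {z. f z = 0 \<and> cmod z \<le> 0} = {z\<in>Z. cmod z \<le> t}"
      using t by (auto simp: Z_def)
    also have "sum m \<dots> = (\<Sum>z\<in>Z. if cmod z \<le> t then m z else 0)"
      using finZ by (simp add: sum.inter_filter)
    finally show ?thesis
      using t by (simp add: sum_divide_distrib) (intro sum.cong, auto)
  qed
  have int: "((\<lambda>t. if t \<in> {cmod z..R} then 1 / t else 0) has_integral ln R - ln (cmod z)) {0..R}"
    if z: "z \<in> Z" for z
  proof (subst has_integral_restrict)
    show "((\<lambda>t. 1 / t) has_integral ln R - ln (cmod z)) {cmod z..R}"
    proof (rule fundamental_theorem_of_calculus)
      fix t assume "t \<in> {cmod z..R}"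
      moreover have "cmod z > 0" using z by (auto simp: Z_def)
      ultimately have "t > 0" unfolding atLeastAtMost_iff by linarith
      then show "(ln has_vector_derivative 1 / t) (at t within {cmod z..R})"
        by (auto intro!: derivative_eq_intros simp: has_real_derivative_iff_has_vector_derivative[symmetric])
    qed (use z in \<open>auto simp: Z_def\<close>)
  qed auto
  have "((\<lambda>t. \<Sum>z\<in>Z. m z * (if t \<in> {cmod z..R} then 1 / t else 0)) has_integral
      (\<Sum>z\<in>Z. m z * (ln R - ln (cmod z)))) {0..R}"
    using finZ int by (intro has_integral_sum has_integral_mult_right) auto
  then have "((\<lambda>t. (n t - n 0) / t) has_integral (\<Sum>z\<in>Z. m z * (ln R - ln (cmod z)))) {0..R}"
    by (rule has_integral_cong[THEN iffD1, rotated]) (use n_eq in auto)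
  then have "integral {0..R} (\<lambda>t. (n t - n 0) / t) = (\<Sum>z\<in>Z. m z * (ln R - ln (cmod z)))"
    by (rule integral_unique)
  then show ?thesis unfolding counting_N_def n_def m_def Z_def by simp
qed

text \<open>Every nonzero zero with \<open>cmod z \<le> r\<close> adds at least \<open>ln 2\<close>
  times its multiplicity to the counting function at radius \<open>2 * r\<close>; hence the constant
  \<open>2 powr s / ln 2\<close>.\<close>

lemma zeros_count_le:
  assumes "zeros_exponent f < ereal s"
  obtains K where "K > 0" "eventually (\<lambda>r. real (\<Sum>z\<in>{z. z \<noteq> 0 \<and> f z = 0 \<and> cmod z \<le> r}. nat (zorder f z))
             \<le> K * r powr s) at_top"
proof (rule that)
  show "2 powr s / ln 2 > (0::real)" by simp
  have "eventually (\<lambda>r. counting_N r (\<lambda>z. 1 / f z) \<le> r powr s) at_top"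
    using assms unfolding zeros_exponent_def by (rule eventually_le_powr_of_Limsup_log_plus)
  then have "eventually (\<lambda>r. counting_N (2 * r) (\<lambda>z. 1 / f z) \<le> (2 * r) powr s) at_top"
    by (rule eventually_compose_filterlim) real_asymp
  then show "eventually (\<lambda>r. real (\<Sum>z\<in>{z. z \<noteq> 0 \<and> f z = 0 \<and> cmod z \<le> r}. nat (zorder f z))
             \<le> 2 powr s / ln 2 * r powr s) at_top"
    using eventually_ge_at_top[of 1]
  proof eventually_elim
    case (elim r)
    define Z where "Z = (\<lambda>r. {z. z \<noteq> 0 \<and> f z = 0 \<and> cmod z \<le> r})"
    have finZ: "finite (Z r)" for r unfolding Z_def by (rule finite_zeros_le)
    define m where "m = (\<lambda>z. real (nat (zorder f z)))"
    have "(\<Sum>z\<in>Z r. m z) * ln 2 = (\<Sum>z\<in>Z r. m z * ln 2)" by (simp add: sum_distrib_right)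
    also have "\<dots> \<le> (\<Sum>z\<in>Z r. m z * (ln (2 * r) - ln (cmod z)))"
    proof (intro sum_mono mult_left_mono)
      fix z assume "z \<in> Z r"
      then have z: "cmod z > 0" "cmod z \<le> r" by (auto simp: Z_def)
      then have "ln (cmod z) \<le> ln r" by (intro ln_mono) linarith+
      moreover have "ln (2 * r) = ln 2 + ln r" using elim by (simp add: ln_mult)
      ultimately show "ln 2 \<le> ln (2 * r) - ln (cmod z)" by simp
    qed (simp add: m_def)
    also have "\<dots> \<le> (\<Sum>z\<in>Z (2 * r). m z * (ln (2 * r) - ln (cmod z)))"
    proof (rule sum_mono2[OF finZ])
      show "Z r \<subseteq> Z (2 * r)" using elim by (auto simp: Z_def)
      fix z assume "z \<in> Z (2 * r) - Z r"
      then have z: "cmod z > 0" "cmod z \<le> 2 * r" by (auto simp: Z_def)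
      then have "ln (cmod z) \<le> ln (2 * r)" by (intro ln_mono) linarith+
      then show "0 \<le> m z * (ln (2 * r) - ln (cmod z))" by (simp add: m_def)
    qed
    \<comment> \<open>A zero at the origin, left out of \<open>Z\<close>, contributes a multiple of
      \<open>ln (2 * r)\<close>, which is nonnegative for \<open>r \<ge> 1\<close>.\<close>
    also have "\<dots> \<le> counting_N (2 * r) (\<lambda>z. 1 / f z)"
      using elim by (subst counting_N_reciprocal) (auto simp: Z_def m_def)
    also have "\<dots> \<le> 2 powr s * r powr s" using elim by (simp add: powr_mult)
    finally show ?case by (simp add: Z_def m_def field_simps)
  qed
qed

end

section \<open>Hadamard factorization\<close>

text \<open>For small \<open>w\<close> the factor differs from 1 by at most
  \<open>3 * cmod w ^ Suc p\<close>, and \<open>\<tau> \<le> p + 1\<close>. For large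
  \<open>w\<close> both \<open>ln (cmod (1 - w))\<close> and the \<open>p\<close> terms of the
  exponent are dominated by the power \<open>\<tau> \<ge> p\<close>.\<close>

lemma norm_weierstrass_factor_le:
  assumes \<tau>: "\<tau> > 0" "real p \<le> \<tau>" "\<tau> \<le> real p + 1"
  shows "cmod (weierstrass_factor p w) \<le> exp ((3 + (real p + 1 + 1 / \<tau>) * 2 powr \<tau>) * cmod w powr \<tau>)"
proof (cases "cmod w \<le> 1 / 2")
  case True
  have "cmod (weierstrass_factor p w) \<le> 1 + cmod (weierstrass_factor p w - 1)"
    using norm_triangle_ineq[of 1 "weierstrass_factor p w - 1"] by simp
  also have "\<dots> \<le> 1 + 3 * cmod w ^ Suc p"
    using weierstrass_factor_bound[OF True, of p] by simp
  also have "cmod w ^ Suc p \<le> cmod w powr \<tau>"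
  proof (cases "w = 0")
    case False
    have "cmod w ^ Suc p = cmod w powr real (Suc p)" using False by (subst powr_realpow) auto
    also have "\<dots> \<le> cmod w powr \<tau>"
      using True \<tau> False by (intro powr_mono') auto
    finally show ?thesis .
  qed simp
  also have "1 + 3 * cmod w powr \<tau> \<le> exp (3 * cmod w powr \<tau>)" by (rule exp_ge_add_one_self)
  also have "\<dots> \<le> exp ((3 + (real p + 1 + 1 / \<tau>) * 2 powr \<tau>) * cmod w powr \<tau>)"
    using \<tau> by (auto intro!: mult_right_mono)
  finally show ?thesis by simp
next
  case False
  \<comment> \<open>Doubling makes the base at least 1, so that powers of \<open>x\<close> increase
    with the exponent.\<close>
  define x where "x = 2 * cmod w"
  have x: "x \<ge> 1" using False by (simp add: x_def)
  have x\<tau>: "x powr \<tau> \<ge> 1" using x \<tau> by (intro ge_one_powr_ge_zero) auto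
  have "cmod (1 - w) \<le> 1 + cmod w" using norm_triangle_ineq4[of 1 w] by simp
  also have "\<dots> \<le> 2 * x" using x by (simp add: x_def)
  also have "\<dots> \<le> exp 1 * exp (ln x)" using x exp_ge_add_one_self[of 1] by (intro mult_mono) auto
  also have "\<dots> = exp (1 + ln x)" by (simp add: exp_add)
  also have "\<dots> \<le> exp (x powr \<tau> + x powr \<tau> / \<tau>)"
    using x\<tau> ln_powr_bound[OF x \<tau>(1)] by simp
  finally have 1: "cmod (1 - w) \<le> exp (x powr \<tau> + x powr \<tau> / \<tau>)" .
  have "cmod (\<Sum>k=1..p. w ^ k / of_nat k) \<le> (\<Sum>k=1..p. x powr \<tau>)"
  proof (rule sum_norm_le)
    fix k assume k: "k \<in> {1..p}"
    have "cmod (w ^ k / of_nat k) = cmod w ^ k / real k" by (simp add: norm_divide norm_power)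
    also have "\<dots> \<le> cmod w ^ k / 1" using k by (intro divide_left_mono) auto
    also have "\<dots> \<le> x ^ k" unfolding div_by_1 using x by (intro power_mono) (auto simp: x_def)
    also have "\<dots> = x powr real k" using x by (subst powr_realpow) auto
    also have "\<dots> \<le> x powr \<tau>" using k \<tau> x by (intro powr_mono) auto
    finally show "cmod (w ^ k / of_nat k) \<le> x powr \<tau>" .
  qed
  then have 2: "Re (\<Sum>k=1..p. w ^ k / of_nat k) \<le> p * x powr \<tau>"
    using complex_Re_le_cmod[of "\<Sum>k=1..p. w ^ k / of_nat k"] by simp
  have "cmod (weierstrass_factor p w) = cmod (1 - w) * exp (Re (\<Sum>k=1..p. w ^ k / of_nat k))"
    by (simp add: weierstrass_factor_def norm_mult)
  also have "\<dots> \<le> exp (x powr \<tau> + x powr \<tau> / \<tau>) * exp (p * x powr \<tau>)"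
    using 1 2 by (intro mult_mono) auto
  also have "\<dots> = exp ((real p + 1 + 1 / \<tau>) * 2 powr \<tau> * cmod w powr \<tau>)"
    by (simp add: x_def powr_mult exp_add[symmetric] algebra_simps)
  also have "\<dots> \<le> exp ((3 + (real p + 1 + 1 / \<tau>) * 2 powr \<tau>) * cmod w powr \<tau>)"
    by (auto intro!: mult_right_mono)
  finally show ?thesis .
qed

text \<open>The exponents in the bounds for the factors add up to a multiple of
  \<open>cmod z powr \<tau>\<close> times the sum of \<open>cmod (a n) powr - \<tau>\<close>;
  convergence follows from the same sum since \<open>\<tau> \<le> p + 1\<close>.\<close>

lemma finite_type_weierstrass_product:
  assumes \<tau>: "\<tau> > 0" "real p \<le> \<tau>" "\<tau> \<le> real p + 1"
    and a0: "\<And>n. a n \<noteq> 0" and lim: "filterlim a at_infinity at_top"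
    and sum: "summable (\<lambda>n. cmod (a n) powr - \<tau>)"
  shows "weierstrass_product a (\<lambda>_. p)" "finite_type \<tau> (weierstrass_product.f a (\<lambda>_. p))"
proof -
  show wp: "weierstrass_product a (\<lambda>_. p)"
  proof
    fix r :: real assume r: "r > 0"
    show "summable (\<lambda>n. (r / cmod (a n)) ^ Suc p)"
    proof (rule summable_comparison_test_ev)
      have "eventually (\<lambda>n. cmod (a n) \<ge> 1) at_top"
        using lim by (simp add: filterlim_at_infinity_conv_norm_at_top filterlim_at_top)
      then show "eventually (\<lambda>n. norm ((r / cmod (a n)) ^ Suc p) \<le> r ^ Suc p * cmod (a n) powr - \<tau>) at_top"
      proof eventually_elim
        case (elim n)
        have "norm ((r / cmod (a n)) ^ Suc p) = r ^ Suc p * cmod (a n) powr - real (Suc p)"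
          using r a0[of n] by (simp add: power_mult_distrib power_inverse powr_minus powr_realpow divide_inverse del: of_nat_Suc power_Suc)
        also have "\<dots> \<le> r ^ Suc p * cmod (a n) powr - \<tau>"
          using elim r \<tau> by (intro mult_left_mono powr_mono) auto
        finally show ?case .
      qed
      show "summable (\<lambda>n. r ^ Suc p * cmod (a n) powr - \<tau>)" by (intro summable_mult sum)
    qed
  qed (use a0 lim in auto)
  interpret weierstrass_product a "\<lambda>_. p" by (rule wp)
  define C where "C = 3 + (real p + 1 + 1 / \<tau>) * 2 powr \<tau>"
  have C: "C \<ge> 0" using \<tau> by (simp add: C_def)
  define S where "S = (\<Sum>n. cmod (a n) powr - \<tau>)"
  show "finite_type \<tau> f"
  proof (rule finite_typeI[of _ "C * S"])
    show "f holomorphic_on UNIV" by (rule holomorphic)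
    fix z
    have "(\<lambda>N. \<Prod>n<N. weierstrass_factor p (z / a n)) \<longlonglongrightarrow> f z"
      using has_prod_imp_tendsto'[OF has_prod] .
    then have "(\<lambda>N. cmod (\<Prod>n<N. weierstrass_factor p (z / a n))) \<longlonglongrightarrow> cmod (f z)"
      by (rule tendsto_norm)
    moreover have "cmod (\<Prod>n<N. weierstrass_factor p (z / a n)) \<le> exp (C * S * (1 + cmod z) powr \<tau>)" for N
    proof -
      have "cmod (\<Prod>n<N. weierstrass_factor p (z / a n)) = (\<Prod>n<N. cmod (weierstrass_factor p (z / a n)))"
        by (simp add: prod_norm)
      also have "\<dots> \<le> (\<Prod>n<N. exp (C * cmod (z / a n) powr \<tau>))"
        unfolding C_def by (intro prod_mono conjI norm_weierstrass_factor_le \<tau>) auto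
      also have "\<dots> = exp (\<Sum>n<N. C * cmod (z / a n) powr \<tau>)" by (simp add: exp_sum)
      also have "(\<Sum>n<N. C * cmod (z / a n) powr \<tau>) = C * cmod z powr \<tau> * (\<Sum>n<N. cmod (a n) powr - \<tau>)"
        by (simp add: sum_distrib_left norm_divide powr_divide powr_minus_divide mult_ac)
      also have "\<dots> \<le> C * (1 + cmod z) powr \<tau> * S"
        unfolding S_def using C \<tau> sum
        by (intro mult_mono powr_mono2 sum_le_suminf sum_nonneg) auto
      finally show ?thesis by (simp add: mult_ac)
    qed
    ultimately show "cmod (f z) \<le> exp (C * S * (1 + cmod z) powr \<tau>)"
      by (intro LIMSEQ_le_const2) auto
  qed
qed

text \<open>Finitely many nonzero zeros give a polynomial. Otherwise they are listed with
  multiplicity by increasing modulus, and the bound on their number makes the Weierstrass product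
  converge. The origin is left out and receives its own factor \<open>z ^ m\<close> later.\<close>

lemma canonical_product_exists:
  assumes f: "f holomorphic_on UNIV" and nz: "\<exists>z. f z \<noteq> 0"
    and \<tau>: "zeros_exponent f < ereal \<tau>"
  obtains P where "finite_type \<tau> P" "P 0 \<noteq> 0" "\<And>z. z \<noteq> 0 \<Longrightarrow> P z = 0 \<longleftrightarrow> f z = 0"
    "\<And>z. z \<noteq> 0 \<Longrightarrow> zorder P z = zorder f z"
proof -
  have "0 \<le> zeros_exponent f" unfolding zeros_exponent_def by (rule Limsup_log_plus_nonneg)
  \<comment> \<open>The gap between \<open>s\<close> and \<open>\<tau>\<close> yields the exponent
    \<open>\<tau> / s > 1\<close> for the convergence of the sum.\<close>
  obtain s where s: "zeros_exponent f < ereal s" "s < \<tau>"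
    using ereal_dense2[OF \<tau>] by auto
  have s0: "s > 0" using s(1) \<open>0 \<le> zeros_exponent f\<close>
    by (metis ereal_less(2) order_le_less_trans)
  then have \<tau>0: "\<tau> > 0" using s by simp
  define Z where "Z = {z. z \<noteq> 0 \<and> f z = 0}"
  note zpos = entire_zorder_pos_iff[OF f nz]
  show ?thesis
  proof (cases "finite Z")
    case True
    define P where "P = (\<lambda>z. \<Prod>w\<in>Z. (z - w) ^ nat (zorder f w))"
    have P_eq_0: "P z = 0 \<longleftrightarrow> z \<in> Z" for z
      using True zpos by (auto simp: P_def Z_def)
    show ?thesis
    proof (rule that)
      show "finite_type \<tau> P"
        unfolding P_def using \<tau>0
        by (intro finite_type_prod finite_type_power finite_type_diff finite_type_ident finite_type_const) auto
      show "P 0 \<noteq> 0" "\<And>z. z \<noteq> 0 \<Longrightarrow> P z = 0 \<longleftrightarrow> f z = 0" by (auto simp: P_eq_0 Z_def)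
      have anaP: "P analytic_on {z}" for z unfolding P_def by (intro analytic_intros)
      show "zorder P z = zorder f z" if "z \<noteq> 0" for z
      proof (cases "f z = 0")
        case False
        have "zorder P z = 0" using False by (intro zorder_eq_0I anaP) (auto simp: P_eq_0 Z_def)
        moreover have "zorder f z = 0"
          using False by (intro zorder_eq_0I entire_analytic_at[OF f nz])
        ultimately show ?thesis by simp
      next
        case fz: True
        define P' where "P' = (\<lambda>w. \<Prod>b\<in>Z - {z}. (w - b) ^ nat (zorder f b))"
        have zZ: "z \<in> Z" using fz that by (simp add: Z_def)
        show ?thesis
        proof (rule zorder_eqI[of UNIV z P'])
          show "P' holomorphic_on UNIV" unfolding P'_def by (intro holomorphic_intros)
          show "P' z \<noteq> 0" using True by (auto simp: P'_def)
          fix w assume "w \<noteq> z"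
          have "P w = (w - z) ^ nat (zorder f z) * P' w"
            unfolding P_def P'_def using True zZ by (rule prod.remove)
          also have "(w - z) ^ nat (zorder f z) = (w - z) powi zorder f z"
            using entire_zorder_nonneg[OF f nz, of z] by (simp add: power_int_def)
          finally show "P w = P' w * (w - z) powi zorder f z" by (simp add: mult.commute)
        qed auto
      qed
    qed
  next
    case False
    obtain a :: "nat \<Rightarrow> complex" where a: "mono (norm \<circ> a)" "range a = Z" "filterlim a at_infinity at_top"
        "\<And>z. z \<in> Z \<Longrightarrow> finite (a -` {z}) \<and> card (a -` {z}) = nat (zorder f z)"
    proof (rule sequence_of_sparse_set_exists'[of Z "\<lambda>z. nat (zorder f z)"])
      show "closed Z"
        unfolding closed_limpt Z_def using entire_zeros_no_limpt[OF f nz] islimpt_subset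
        by (metis (mono_tags, lifting) Collect_mono)
      show "finite (Z \<inter> cball 0 r)" for r
        by (rule finite_subset[OF _ entire_zeros_finite[OF f nz, of r]]) (auto simp: Z_def)
      show "nat (zorder f z) > 0" if "z \<in> Z" for z using that zpos by (auto simp: Z_def)
      show "infinite Z" by (rule False)
    qed (rule that)
    have a0: "a n \<noteq> 0" for n using a(2) by (auto simp: Z_def)
    obtain K where K: "K > 0" "eventually (\<lambda>r. real (\<Sum>z\<in>{z. z \<noteq> 0 \<and> f z = 0 \<and> cmod z \<le> r}. nat (zorder f z))
             \<le> K * r powr s) at_top"
      using zeros_count_le[OF f nz s(1)] by blast
    have lim: "filterlim (\<lambda>n. cmod (a n)) at_top at_top"
      using a(3) by (simp add: filterlim_at_infinity_conv_norm_at_top)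
    \<comment> \<open>The points \<open>a 0\<close> to \<open>a n\<close> all have modulus at most
      \<open>cmod (a n)\<close>, and each zero is listed as often as its multiplicity, so the count
      at that radius is at least \<open>n + 1\<close>.\<close>
    have ev: "eventually (\<lambda>n. real (Suc n) \<le> K * cmod (a n) powr s) at_top"
      using eventually_compose_filterlim[OF K(2) lim]
    proof eventually_elim
      case (elim n)
      define Zn where "Zn = {z. z \<noteq> 0 \<and> f z = 0 \<and> cmod z \<le> cmod (a n)}"
      have Zn: "finite Zn" "Zn \<subseteq> Z"
        unfolding Zn_def using finite_zeros_le[OF f nz] by (auto simp: Z_def)
      have "{..n} \<subseteq> (\<Union>z\<in>Zn. a -` {z})"
      proof
        fix i assume "i \<in> {..n}"
        then have "cmod (a i) \<le> cmod (a n)" using monoD[OF a(1), of i n] by simp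
        moreover have "a i \<in> Z" using a(2) by blast
        ultimately show "i \<in> (\<Union>z\<in>Zn. a -` {z})" by (auto simp: Zn_def Z_def)
      qed
      then have "card {..n} \<le> card (\<Union>z\<in>Zn. a -` {z})"
        using Zn a(4) by (intro card_mono) auto
      also have "\<dots> \<le> (\<Sum>z\<in>Zn. card (a -` {z}))" by (rule card_UN_le[OF Zn(1)])
      also have "\<dots> = (\<Sum>z\<in>Zn. nat (zorder f z))"
        using Zn a(4) by (intro sum.cong) auto
      finally have "real (Suc n) \<le> real (\<Sum>z\<in>Zn. nat (zorder f z))"
        unfolding of_nat_le_iff by simp
      also have "\<dots> \<le> K * cmod (a n) powr s" using elim unfolding Zn_def .
      finally show ?case .
    qed
    have sum: "summable (\<lambda>n. cmod (a n) powr - \<tau>)"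
    proof (rule summable_comparison_test_ev)
      show "eventually (\<lambda>n. norm (cmod (a n) powr - \<tau>) \<le> K powr (\<tau> / s) * real (Suc n) powr - (\<tau> / s)) at_top"
        using ev
      proof eventually_elim
        case (elim n)
        have "real (Suc n) powr (\<tau> / s) \<le> (K * cmod (a n) powr s) powr (\<tau> / s)"
          using elim \<tau>0 s0 by (intro powr_mono2) auto
        also have "\<dots> = K powr (\<tau> / s) * cmod (a n) powr \<tau>"
          using s0 by (simp add: powr_mult powr_powr)
        finally have "real (Suc n) powr (\<tau> / s) \<le> K powr (\<tau> / s) * cmod (a n) powr \<tau>" .
        then show ?case using a0[of n] by (simp add: powr_minus field_simps)
      qed
      have "summable (\<lambda>n. real n powr - (\<tau> / s))"
        using s s0 by (subst summable_real_powr_iff) (simp add: field_simps)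
      then have "summable (\<lambda>n. real (Suc n) powr - (\<tau> / s))" by (subst summable_Suc_iff)
      then show "summable (\<lambda>n. K powr (\<tau> / s) * real (Suc n) powr - (\<tau> / s))" by (rule summable_mult)
    qed
    \<comment> \<open>The genus: the integer part places \<open>\<tau>\<close> between
      \<open>p\<close> and \<open>p + 1\<close>.\<close>
    define p where "p = nat \<lfloor>\<tau>\<rfloor>"
    have p: "real p \<le> \<tau>" "\<tau> \<le> real p + 1" using \<tau>0 unfolding p_def by linarith+
    note * = finite_type_weierstrass_product[OF \<tau>0 p a0 a(3) sum]
    interpret W: weierstrass_product a "\<lambda>_. p" by (rule *(1))
    show ?thesis
    proof (rule that[of W.f])
      show "W.f 0 \<noteq> 0" "\<And>z. z \<noteq> 0 \<Longrightarrow> W.f z = 0 \<longleftrightarrow> f z = 0"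
        by (auto simp: W.zero a(2)) (auto simp: Z_def)
      fix z :: complex assume z: "z \<noteq> 0"
      show "zorder W.f z = zorder f z"
      proof (cases "f z = 0")
        case True
        then show ?thesis using a(4)[of z] z entire_zorder_nonneg[OF f nz, of z]
          by (simp add: W.zorder Z_def)
      next
        case False
        then have "a -` {z} = {}" using a(2) by (auto simp: Z_def)
        moreover have "zorder f z = 0"
          using False by (intro zorder_eq_0I entire_analytic_at[OF f nz])
        ultimately show ?thesis by (simp add: W.zorder)
      qed
    qed (use *(2) in auto)
  qed
qed

section \<open>The exponential factor and its Taylor coefficients\<close>

lemma ex_zero_free_radius:
  assumes "f holomorphic_on UNIV" "\<exists>z. f z \<noteq> 0"
  shows "\<exists>r>R. \<forall>z. cmod z = r \<longrightarrow> f z \<noteq> 0"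
proof -
  define B where "B = cmod ` ({w. f w = 0} \<inter> cball 0 (R + 1))"
  have "finite B" unfolding B_def using entire_zeros_finite[OF assms] by blast
  then have "infinite ({R<..<R + 1} - B)" by (intro Diff_infinite_finite) auto
  then obtain r where r: "r \<in> {R<..<R + 1}" "r \<notin> B" by (meson DiffE finite.emptyI finite_subset subsetI)
  then have "f z \<noteq> 0" if "cmod z = r" for z
    using that by (auto simp: B_def)
  then show ?thesis using r by auto
qed

lemma entire_eq_poly:
  assumes g: "g holomorphic_on UNIV" and d: "\<And>n. n > d \<Longrightarrow> (deriv ^^ n) g 0 = 0"
  obtains p where "degree p \<le> d" "\<And>z. g z = poly p z"
proof
  define p where "p = (\<Sum>i\<le>d. monom ((deriv ^^ i) g 0 / fact i) i)"
  show "degree p \<le> d"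
    unfolding p_def by (intro degree_sum_le) (auto intro: order_trans[OF degree_monom_le])
  fix z
  have "(\<lambda>n. (deriv ^^ n) g 0 / fact n * (z - 0) ^ n) sums g z"
    by (rule holomorphic_power_series[of g 0 "cmod z + 1"]) (auto intro: holomorphic_on_subset[OF g])
  moreover have "(\<lambda>n. (deriv ^^ n) g 0 / fact n * (z - 0) ^ n) sums
      (\<Sum>n\<le>d. (deriv ^^ n) g 0 / fact n * (z - 0) ^ n)"
    by (rule sums_finite) (use d in \<open>auto simp: not_le\<close>)
  ultimately have "g z = (\<Sum>n\<le>d. (deriv ^^ n) g 0 / fact n * (z - 0) ^ n)"
    by (rule sums_unique2)
  then show "g z = poly p z" by (simp add: p_def poly_sum poly_monom)
qed

text \<open>Integrating a pointwise bound for the modulus of \<open>Re g\<close> brings in the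
  proximity function of \<open>f\<close>, the mean \<open>Re (g 0)\<close>, and the mean of
  \<open>ln (cmod P)\<close>, which is at least \<open>ln (cmod (P 0))\<close>.\<close>

lemma coefficient_le_proximity:
  assumes f: "f holomorphic_on UNIV" and P: "P holomorphic_on UNIV" and g: "g holomorphic_on UNIV"
    and eq: "\<And>z. f z = z ^ m * P z * exp (g z)"
    and r: "r \<ge> 1" "\<And>z. cmod z = r \<Longrightarrow> P z \<noteq> 0" and P0: "P 0 \<noteq> 0"
    and B: "B \<ge> 0" "\<And>z. cmod z = r \<Longrightarrow> cmod (P z) \<le> exp B" and n: "n > 0"
  shows "cmod ((deriv ^^ n) g 0 / fact n) * r ^ n \<le>
    4 * proximity r f + 4 * B - 4 * ln (cmod (P 0)) - 2 * Re (g 0)"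
proof -
  define \<zeta> where "\<zeta> = (\<lambda>t. of_real r * cis t)"
  have n\<zeta>: "cmod (\<zeta> t) = r" for t using r by (simp add: \<zeta>_def norm_mult)
  have Pnz: "P (\<zeta> t) \<noteq> 0" for t using r n\<zeta> by simp
  \<comment> \<open>The bracket is nonnegative and at least \<open>Re g\<close>, where
    \<open>r \<ge> 1\<close> disposes of the factor \<open>r ^ m\<close>; so it dominates the
    positive part, and a modulus is twice the positive part minus the number.\<close>
  have pt: "\<bar>Re (g (\<zeta> t))\<bar> \<le> 2 * (log_plus (cmod (f (\<zeta> t))) + B - ln (cmod (P (\<zeta> t)))) - Re (g (\<zeta> t))" for t
  proof -
    have fpos: "cmod (f (\<zeta> t)) = r ^ m * cmod (P (\<zeta> t)) * exp (Re (g (\<zeta> t)))"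
      by (simp add: eq norm_mult norm_power n\<zeta>)
    have "ln (cmod (f (\<zeta> t))) = m * ln r + ln (cmod (P (\<zeta> t))) + Re (g (\<zeta> t))"
      unfolding fpos using r Pnz[of t] by (simp add: ln_mult ln_realpow)
    moreover have "0 \<le> m * ln r" using r by simp
    ultimately have 1: "Re (g (\<zeta> t)) \<le> ln (cmod (f (\<zeta> t))) - ln (cmod (P (\<zeta> t)))" by linarith
    have "cmod (f (\<zeta> t)) > 0" unfolding fpos using r Pnz[of t] by simp
    then have 2: "ln (cmod (f (\<zeta> t))) \<le> log_plus (cmod (f (\<zeta> t)))" by (rule ln_le_log_plus)
    have "ln (cmod (P (\<zeta> t))) \<le> ln (exp B)"
      using B(2)[OF n\<zeta>[of t]] Pnz[of t] by (intro ln_mono) auto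
    then have 3: "ln (cmod (P (\<zeta> t))) \<le> B" by simp
    show ?thesis using 1 2 3 B(1) log_plus_nonneg[of "cmod (f (\<zeta> t))"] by (simp add: abs_if)
  qed
  have cont: "continuous_on {0..2 * pi} (\<lambda>t. h (\<zeta> t))" if "h holomorphic_on UNIV" for h :: "complex \<Rightarrow> complex"
    unfolding \<zeta>_def
    by (intro continuous_on_compose2[OF holomorphic_on_imp_continuous_on[OF that]] continuous_intros) auto
  have int1: "(\<lambda>t. log_plus (cmod (f (\<zeta> t)))) integrable_on {0..2 * pi}"
    unfolding \<zeta>_def by (rule proximity_integrable[OF f])
  have int2: "(\<lambda>t. ln (cmod (P (\<zeta> t)))) integrable_on {0..2 * pi}"
    by (intro integrable_continuous_real continuous_intros cont P) (use Pnz in auto)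
  have "((\<lambda>t. g (\<zeta> t)) has_integral 2 * pi * g 0) {0..2 * pi}"
    unfolding \<zeta>_def using g r by (intro circle_mean_has_integral) auto
  from has_integral_linear[OF this bounded_linear_Re]
  have int3: "((\<lambda>t. Re (g (\<zeta> t))) has_integral 2 * pi * Re (g 0)) {0..2 * pi}" by (simp add: o_def)
  have int4: "((\<lambda>t. log_plus (cmod (f (\<zeta> t)))) has_integral 2 * pi * proximity r f) {0..2 * pi}"
    using int1 by (simp add: has_integral_integrable_integral proximity_def \<zeta>_def)
  define L where "L = integral {0..2 * pi} (\<lambda>t. ln (cmod (P (\<zeta> t))))"
  have int5: "((\<lambda>t. ln (cmod (P (\<zeta> t)))) has_integral L) {0..2 * pi}"
    using int2 by (simp add: has_integral_integrable_integral L_def)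
  have L: "2 * pi * ln (cmod (P 0)) \<le> L"
    unfolding L_def \<zeta>_def using P P0 r by (intro ln_norm_le_circle_mean) auto
  have int6: "((\<lambda>t. B) has_integral 2 * pi * B) {0..2 * pi}"
    using has_integral_const_real[of B 0 "2 * pi"] by simp
  have int7: "((\<lambda>t. 2 * (log_plus (cmod (f (\<zeta> t))) + B - ln (cmod (P (\<zeta> t)))) - Re (g (\<zeta> t))) has_integral
      2 * (2 * pi * proximity r f + 2 * pi * B - L) - 2 * pi * Re (g 0)) {0..2 * pi}"
    by (intro has_integral_diff has_integral_add has_integral_mult_right int3 int4 int5 int6)
  have "pi * cmod ((deriv ^^ n) g 0 / fact n) * r ^ n \<le> integral {0..2 * pi} (\<lambda>t. \<bar>Re (g (\<zeta> t))\<bar>)"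
    unfolding \<zeta>_def using g r n by (intro norm_coefficient_le_integral_abs_Re) auto
  also have "\<dots> \<le> integral {0..2 * pi} (\<lambda>t. 2 * (log_plus (cmod (f (\<zeta> t))) + B - ln (cmod (P (\<zeta> t)))) - Re (g (\<zeta> t)))"
  proof (rule integral_le)
    show "(\<lambda>t. \<bar>Re (g (\<zeta> t))\<bar>) integrable_on {0..2 * pi}"
      by (intro integrable_continuous_real continuous_intros cont g)
  qed (use pt int7 in \<open>auto simp only: has_integral_integrable\<close>)
  also have "\<dots> = 2 * (2 * pi * proximity r f + 2 * pi * B - L) - 2 * pi * Re (g 0)"
    using int7 by (rule integral_unique)
  also have "\<dots> \<le> pi * (4 * proximity r f + 4 * B - 4 * ln (cmod (P 0)) - 2 * Re (g 0))"
    using L by (simp add: algebra_simps)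
  finally show ?thesis by (simp add: mult.assoc)
qed

text \<open>Beyond the factorization this shows that the order is an integer: the coefficient bound
  gives \<open>degree p \<le> \<sigma>'\<close>, and the growth of the product gives the converse.
  The \<open>P\<close> obtained includes the factor \<open>z ^ m\<close> for the zero at the
  origin.\<close>

lemma hadamard_factorization:
  assumes f: "f holomorphic_on UNIV" and nz: "\<exists>z. f z \<noteq> 0"
    and \<sigma>: "growth_order f < \<infinity>" and \<lambda>: "zeros_exponent f < growth_order f"
  obtains P p \<tau> where "finite_type \<tau> P" "0 < \<tau>" "\<tau> < real (degree p)"
    "growth_order f = ereal (real (degree p))" "\<And>z. f z = P z * exp (poly p z)"
proof -
  have "0 \<le> zeros_exponent f" unfolding zeros_exponent_def by (rule Limsup_log_plus_nonneg)
  then obtain \<sigma>' where \<sigma>': "growth_order f = ereal \<sigma>'"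
    using \<sigma> \<lambda> by (cases "growth_order f") auto
  obtain \<tau> where \<tau>: "zeros_exponent f < ereal \<tau>" "\<tau> < \<sigma>'"
    using ereal_dense2[OF \<lambda>] unfolding \<sigma>' by auto
  have \<tau>0: "0 < \<tau>" using \<tau>(1) \<open>0 \<le> zeros_exponent f\<close> by (metis ereal_less(2) order_le_less_trans)
  obtain P where P: "finite_type \<tau> P" "P 0 \<noteq> 0" "\<And>z. z \<noteq> 0 \<Longrightarrow> P z = 0 \<longleftrightarrow> f z = 0"
    "\<And>z. z \<noteq> 0 \<Longrightarrow> zorder P z = zorder f z"
    using canonical_product_exists[OF f nz \<tau>(1)] by blast
  have holP: "P holomorphic_on UNIV" using P(1) finite_type_holomorphic by blast
  define m where "m = nat (zorder f 0)"
  have m: "int m = zorder f 0" using entire_zorder_nonneg[OF f nz] by (simp add: m_def)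
  define F where "F = (\<lambda>z. z ^ m * P z)"
  have holF: "F holomorphic_on UNIV" unfolding F_def by (intro holomorphic_intros holP)
  have F0: "F z = 0 \<longleftrightarrow> f z = 0" for z
    using P(2) P(3)[of z] m entire_zorder_pos_iff[OF f nz, of 0] by (cases "z = 0") (auto simp: F_def)
  have zF: "zorder F z = zorder f z" for z
  proof (cases "z = 0")
    case True
    show ?thesis unfolding True
    proof (rule zorder_eqI[of UNIV 0 P])
      show "F w = P w * (w - 0) powi zorder f 0" if "w \<noteq> 0" for w
        by (simp add: F_def m[symmetric] mult.commute)
    qed (use holP P in auto)
  next
    case False
    have nzF: "\<exists>z. F z \<noteq> 0" using nz F0 by blast
    have "zorder F z = zorder (\<lambda>z. z ^ m) z + zorder P z"
      unfolding F_def
    proof (rule zorder_times_analytic)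
      show "P analytic_on {z}" using holP by (rule entire_analytic_at) (use P(2) in blast)
      show "eventually (\<lambda>z. z ^ m * P z \<noteq> 0) (at z)"
        using entire_eventually_nonzero[OF holF nzF, of z] unfolding F_def .
    qed (auto intro!: analytic_intros)
    moreover have "zorder (\<lambda>z. z ^ m) z = 0"
      by (intro zorder_eq_0I analytic_intros) (use False in auto)
    ultimately show ?thesis using P(4)[OF False] by simp
  qed
  \<comment> \<open>\<open>f\<close> and \<open>F\<close> have the same zeros with the same orders,
    so their quotient is entire without zeros and has a logarithm on the plane.\<close>
  obtain h where h: "h holomorphic_on UNIV" "\<And>z. h z \<noteq> 0" "\<And>z. f z = h z * F z"
    using holomorphic_zorder_factorization[OF f open_UNIV connected_UNIV holF F0 zF] by auto
  obtain g where g: "g holomorphic_on UNIV" "\<And>z. h z = exp (g z)"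
    using contractible_imp_holomorphic_log[OF h(1) contractible_UNIV h(2)] by auto
  have eq: "f z = z ^ m * P z * exp (g z)" for z
    using h(3)[of z] g(2)[of z] by (simp add: F_def)
  obtain C where C: "C \<ge> 0" "\<And>z. cmod (P z) \<le> exp (C * (1 + cmod z) powr \<tau>)"
    using finite_typeE[OF P(1)] by blast
  \<comment> \<open>With \<open>s\<close> between \<open>\<sigma>'\<close> and \<open>n\<close>, the
    coefficient bound divided by \<open>r ^ n\<close> tends to 0, so some large circle refutes a
    nonzero coefficient.\<close>
  have vanish: "(deriv ^^ n) g 0 = 0" if n: "real n > \<sigma>'" for n
  proof (rule ccontr)
    assume neq: "(deriv ^^ n) g 0 \<noteq> 0"
    define b where "b = cmod ((deriv ^^ n) g 0 / fact n)"
    have b: "b > 0" using neq by (simp add: b_def)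
    obtain s where s: "\<sigma>' < s" "s < real n" using dense[OF n] by blast
    have n0: "n > 0" using n \<tau> \<tau>0 by (cases n) auto
    define K where "K = - 4 * ln (cmod (P 0)) - 2 * Re (g 0)"
    have "((\<lambda>r. 4 * (r powr s / r powr n) + 4 * C * ((1 + r) powr \<tau> / r powr n) + K * (1 / r powr n)) \<longlongrightarrow>
        4 * 0 + 4 * C * 0 + K * 0) at_top"
    proof (intro tendsto_add tendsto_mult tendsto_const)
      show "((\<lambda>r. r powr s / r powr real n) \<longlongrightarrow> 0) at_top" using s by real_asymp
      have "\<tau> < real n" using n \<tau> by simp
      then show "((\<lambda>r. (1 + r) powr \<tau> / r powr real n) \<longlongrightarrow> 0) at_top" by real_asymp
      have "0 < real n" using n0 by simp
      then show "((\<lambda>r. 1 / r powr real n) \<longlongrightarrow> 0) at_top" by real_asymp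
    qed
    then have "((\<lambda>r. 4 * (r powr s / r powr n) + 4 * C * ((1 + r) powr \<tau> / r powr n) + K * (1 / r powr n)) \<longlongrightarrow> 0) at_top"
      by simp
    then have "eventually (\<lambda>r. 4 * (r powr s / r powr n) + 4 * C * ((1 + r) powr \<tau> / r powr n) + K * (1 / r powr n) < b) at_top"
      using b by (rule order_tendstoD)
    moreover have "eventually (\<lambda>r. proximity r f \<le> r powr s) at_top"
      using growth_order_less_imp_proximity_le[OF f] \<sigma>' s by simp
    ultimately have "eventually (\<lambda>r. 4 * (r powr s / r powr n) + 4 * C * ((1 + r) powr \<tau> / r powr n) + K * (1 / r powr n) < b
        \<and> proximity r f \<le> r powr s \<and> r \<ge> 1) at_top"
      using eventually_ge_at_top[of 1] by eventually_elim auto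
    then obtain R where R: "\<And>r. r \<ge> R \<Longrightarrow> 4 * (r powr s / r powr n) + 4 * C * ((1 + r) powr \<tau> / r powr n) + K * (1 / r powr n) < b
        \<and> proximity r f \<le> r powr s \<and> r \<ge> 1"
      unfolding eventually_at_top_linorder by blast
    \<comment> \<open>The circle has to avoid the zeros of \<open>P\<close>, where
      \<open>ln (cmod P)\<close> would be singular.\<close>
    obtain r where r: "r > R" "\<And>z. cmod z = r \<Longrightarrow> P z \<noteq> 0"
      using ex_zero_free_radius[OF holP] P(2) by blast
    have r': "4 * (r powr s / r powr n) + 4 * C * ((1 + r) powr \<tau> / r powr n) + K * (1 / r powr n) < b"
        "proximity r f \<le> r powr s" "r \<ge> 1"
      using R[of r] r(1) by auto
    have "b * r ^ n \<le> 4 * proximity r f + 4 * (C * (1 + r) powr \<tau>) - 4 * ln (cmod (P 0)) - 2 * Re (g 0)"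
      unfolding b_def
      by (rule coefficient_le_proximity[OF f holP g(1) eq r'(3) r(2) P(2)]) (use C n0 r' in auto)
    also have "\<dots> \<le> 4 * r powr s + 4 * C * (1 + r) powr \<tau> + K" using r'(2) by (simp add: K_def)
    also have "\<dots> = (4 * (r powr s / r powr n) + 4 * C * ((1 + r) powr \<tau> / r powr n) + K * (1 / r powr n)) * r powr n"
      using r' by (simp add: field_simps)
    also have "\<dots> < b * r powr n" using r' by (intro mult_strict_right_mono) auto
    finally show False using r' by (simp add: powr_realpow)
  qed
  have vanish': "(deriv ^^ n) g 0 = 0" if "n > nat \<lfloor>\<sigma>'\<rfloor>" for n
    using that by (intro vanish) linarith
  obtain p where p: "degree p \<le> nat \<lfloor>\<sigma>'\<rfloor>" "\<And>z. g z = poly p z"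
    using entire_eq_poly[OF g(1) vanish'] by blast
  have le: "real (degree p) \<le> \<sigma>'" using p(1) \<tau> \<tau>0 by linarith
  define s where "s = max \<tau> (real (degree p))"
  have ftF: "finite_type \<tau> F" unfolding F_def using \<tau>0 P(1)
    by (intro finite_type_mult finite_type_power finite_type_ident) auto
  have "finite_type s (\<lambda>z. F z * exp (poly p z))"
    using finite_type_mono[OF ftF, of s] finite_type_exp_poly[of p s] by (auto simp: s_def)
  moreover have fF: "f = (\<lambda>z. F z * exp (poly p z))" using h(3) g(2) p(2) by (simp add: fun_eq_iff)
  ultimately have "finite_type s f" by simp
  then have "growth_order f \<le> ereal s" by (rule growth_order_finite_type) (simp add: s_def)
  \<comment> \<open>The maximum in \<open>s\<close> cannot be \<open>\<tau>\<close>, which is below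
    \<open>\<sigma>'\<close>.\<close>
  then have "\<sigma>' \<le> real (degree p)" using \<tau> by (auto simp: \<sigma>' s_def max_def split: if_splits)
  then have deg: "real (degree p) = \<sigma>'" using le by simp
  show ?thesis
    by (rule that[OF ftF \<tau>0, of p]) (use deg \<tau> \<sigma>' fF in auto)
qed

section \<open>The functional equation\<close>

text \<open>A translation keeps the leading coefficient, so at the degree of \<open>p\<close> the
  combination has coefficient that of \<open>Q\<close> minus that of \<open>p\<close>; above this
  degree only \<open>Q\<close> contributes.\<close>

lemma degree_shift_cancel:
  fixes p Q :: "complex poly"
  assumes k: "degree p > 0" and g: "degree (Q + p \<circ>\<^sub>p [:c, 1:] - smult 2 p) < degree p"
  shows "degree Q = degree p"
proof (rule antisym)
  define pc where "pc = p \<circ>\<^sub>p [:c, 1:]"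
  have dpc: "degree pc = degree p" by (simp add: pc_def degree_pcompose)
  have "lead_coeff pc = lead_coeff p" unfolding pc_def by (subst lead_coeff_comp) auto
  then have lc: "coeff pc (degree p) = coeff p (degree p)" by (simp add: dpc)
  have "coeff (Q + pc - smult 2 p) (degree p) = 0" using g unfolding pc_def by (rule coeff_eq_0)
  then have "coeff Q (degree p) = coeff p (degree p)" by (simp add: lc)
  also have "\<dots> \<noteq> 0" using k by (metis leading_coeff_0_iff degree_0 less_irrefl)
  finally show "degree p \<le> degree Q" by (rule le_degree)
  show "degree Q \<le> degree p"
  proof (rule degree_le, safe)
    fix i assume i: "degree p < i"
    have "coeff (Q + pc - smult 2 p) i = 0" using g i unfolding pc_def by (intro coeff_eq_0) simp
    then show "coeff Q i = 0" using i by (simp add: coeff_eq_0 dpc)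
  qed
qed

text \<open>The three-term theorem makes one of \<open>g\<close>, \<open>h\<close> and
  \<open>g - h\<close> small in degree. Two of the three terms then merge into a single one of
  finite type, and the two-term statement bounds the remaining exponent.\<close>

lemma borel_degrees:
  fixes \<rho> :: real
  assumes ft: "finite_type \<rho> A" "finite_type \<rho> B" "finite_type \<rho> C" and \<rho>: "\<rho> > 0"
    and nz: "\<exists>z. A z \<noteq> 0" "\<exists>z. B z \<noteq> 0" "\<exists>z. C z \<noteq> 0"
    and eq: "\<And>z. A z + B z * exp (poly g z) + C z * exp (poly h z) = 0"
  shows "degree g \<le> \<rho> \<and> degree h \<le> \<rho>"
proof -
  have 1: "degree h \<le> \<rho>" if "degree g \<le> \<rho>"
  proof (rule ccontr)
    assume h: "\<not> degree h \<le> \<rho>"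
    have "C z * exp (poly h z) = - 1 * (A z + B z * exp (poly g z))" for z
      using eq[of z] by algebra
    then have "C z = 0" for z
      using ft \<rho> h that
      by (intro finite_type_mult_exp_eq_0[of \<rho> C "\<lambda>z. - 1 * (A z + B z * exp (poly g z))" h]
          finite_type_mult finite_type_add finite_type_const finite_type_exp_poly) auto
    then show False using nz by blast
  qed
  have 2: "degree g \<le> \<rho>" if "degree h \<le> \<rho>"
  proof (rule ccontr)
    assume h: "\<not> degree g \<le> \<rho>"
    have "B z * exp (poly g z) = - 1 * (A z + C z * exp (poly h z))" for z
      using eq[of z] by algebra
    then have "B z = 0" for z
      using ft \<rho> h that
      by (intro finite_type_mult_exp_eq_0[of \<rho> B "\<lambda>z. - 1 * (A z + C z * exp (poly h z))" g]
          finite_type_mult finite_type_add finite_type_const finite_type_exp_poly) auto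
    then show False using nz by blast
  qed
  have 3: "degree h \<le> \<rho>" if "degree (g - h) \<le> \<rho>"
  proof (rule ccontr)
    assume h: "\<not> degree h \<le> \<rho>"
    have "A z * exp (poly (- h) z) = - 1 * (C z + B z * exp (poly (g - h) z))" for z
    proof -
      have "A z * exp (poly (- h) z) + (C z + B z * exp (poly (g - h) z)) =
          (A z + B z * exp (poly g z) + C z * exp (poly h z)) * exp (- poly h z)"
        by (simp add: exp_diff exp_minus field_simps)
      then have "A z * exp (poly (- h) z) + (C z + B z * exp (poly (g - h) z)) = 0"
        by (simp only: eq mult_zero_left)
      then show ?thesis by algebra
    qed
    then have "A z = 0" for z
      using ft \<rho> h that
      by (intro finite_type_mult_exp_eq_0[of \<rho> A "\<lambda>z. - 1 * (C z + B z * exp (poly (g - h) z))" "- h"]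
          finite_type_mult finite_type_add finite_type_const finite_type_exp_poly) auto
    then show False using nz by blast
  qed
  have "degree g \<le> \<rho> \<or> degree h \<le> \<rho> \<or> degree (g - h) \<le> \<rho>"
    using borel_three_term[OF ft \<rho> _ _ _ eq] nz by (meson not_le)
  then show ?thesis using 1 2 3 by blast
qed

theorem theorem1p3:
  fixes c \<omega> :: complex
    and q Q u v :: "complex poly"
    and f :: "complex \<Rightarrow> complex"
  assumes "c \<noteq> 0" and "\<omega> \<noteq> 0"
    and "degree Q > 0" and "degree v > 0"
    and "q \<noteq> 0" and "u \<noteq> 0"
    and "transcendental_entire f"
    and "growth_order f < \<infinity>"
    and "\<And>z. (f z)\<^sup>2 + \<omega> * f z * deriv f z + poly q z * exp (poly Q z) * f (z + c)
              = poly u z * exp (poly v z)"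
    and "zeros_exponent f < growth_order f"
  shows "degree Q = degree v \<and>
    ((growth_order f < ereal (real (degree Q)) \<and> (\<exists>C. \<forall>z. f z = C * exp (- z / \<omega>)))
     \<or> growth_order f = ereal (real (degree Q)))"
proof -
  have f: "f holomorphic_on UNIV" using assms(7) by (simp add: transcendental_entire_def)
  have nz: "\<exists>z. f z \<noteq> 0"
  proof (rule ccontr)
    assume "\<not> ?thesis"
    then have "\<forall>z. f z = poly 0 z" by simp
    then show False using assms(7) unfolding transcendental_entire_def by blast
  qed
  obtain P p \<tau> where P: "finite_type \<tau> P" "0 < \<tau>" "\<tau> < real (degree p)"
      "growth_order f = ereal (real (degree p))" "\<And>z. f z = P z * exp (poly p z)"
    by (rule hadamard_factorization[OF f nz assms(8,10)]) (rule that)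
  have Pnz: "\<exists>z. P z \<noteq> 0" using nz P(5) by auto
  have k: "degree p > 0" using P(2,3) by (cases "degree p") auto
  \<comment> \<open>Large enough for \<open>P\<close>, still below the degree of \<open>p\<close>,
    and at least 1 less than it, so that exponents of degree up to \<open>degree p - 1\<close> count
    as small.\<close>
  define \<rho> where "\<rho> = max \<tau> (real (degree p - 1))"
  have \<rho>: "\<rho> > 0" "\<rho> < degree p" "real (degree p - 1) \<le> \<rho>" using P(2,3) k by (auto simp: \<rho>_def)
  have ftP: "finite_type \<rho> P" using P(1) by (rule finite_type_mono) (simp add: \<rho>_def)
  have holP: "P holomorphic_on UNIV" using finite_type_holomorphic[OF ftP] .
  \<comment> \<open>The first two terms of the equation are \<open>f * (f + \<omega> * f')\<close>,
    that is, \<open>P * D * exp (2 * p)\<close>; whether \<open>D\<close> vanishes separates the two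
    cases.\<close>
  define D where "D = (\<lambda>z. P z + \<omega> * (deriv P z + poly (pderiv p) z * P z))"
  have ftD: "finite_type \<rho> D"
    unfolding D_def using \<rho> ftP
    by (intro finite_type_add finite_type_mult finite_type_deriv finite_type_poly finite_type_const) auto
  have df: "deriv f z = (deriv P z + poly (pderiv p) z * P z) * exp (poly p z)" for z
  proof -
    have dP: "(P has_field_derivative deriv P z) (at z)" using holP holomorphic_derivI by blast
    have "((\<lambda>z. P z * exp (poly p z)) has_field_derivative
        (deriv P z + poly (pderiv p) z * P z) * exp (poly p z)) (at z)"
      by (rule derivative_eq_intros dP poly_DERIV refl)+ (simp add: algebra_simps)
    then show ?thesis unfolding P(5)[abs_def] by (rule DERIV_imp_deriv)
  qed
  have D: "f z + \<omega> * deriv f z = D z * exp (poly p z)" for z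
    by (simp add: df D_def P(5) algebra_simps)
  show ?thesis
  proof (cases "\<forall>z. D z = 0")
    case True
    define l where "l = [:0, - 1 / \<omega>:]"
    have "deriv f z * 1 = f z * (deriv (\<lambda>_. 1) z + poly (pderiv l) z * 1)" for z
    proof -
      have "f z + \<omega> * deriv f z = 0" by (simp add: D True)
      then have "deriv f z = - f z / \<omega>" using assms(2) by (simp add: field_simps add_eq_0_iff2)
      then show ?thesis by (simp add: l_def pderiv_pCons)
    qed
    then obtain C where C: "\<And>z. f z = C * 1 * exp (poly l z)"
      using logderiv_eq_imp_exp_multiple[of f "\<lambda>_. 1" l] f by auto
    have C0: "C \<noteq> 0" using C nz by auto
    have fC: "f z = C * exp (- z / \<omega>)" for z using C[of z] by (simp add: l_def)
    have deg_l: "degree l = 1" using assms(2) by (simp add: l_def)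
    \<comment> \<open>Comparing both forms of \<open>f\<close> gives
      \<open>P * exp (p - l) = C\<close>; if \<open>p\<close> had degree above 1, this would force
      \<open>P = 0\<close>. Hence the order is 1.\<close>
    have deg_p: "degree p = 1"
    proof (rule ccontr)
      assume "degree p \<noteq> 1"
      then have "degree l < degree p" using k deg_l by simp
      then have "degree (p - l) = degree p"
        using degree_add_eq_left[of "- l" p] by simp
      moreover have "P z * exp (poly (p - l) z) = C" for z
        using P(5)[of z] C[of z] by (simp add: exp_diff field_simps)
      ultimately have "P z = 0" for z
        using \<rho> ftP by (intro finite_type_mult_exp_eq_0[of \<rho> P "\<lambda>_. C" "p - l"]) auto
      then show False using Pnz by blast
    qed
    define G where "G = Q + l - v"
    have eqG: "poly q z * (C * exp (poly l c)) * exp (poly G z) = poly u z" for z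
    proof -
      have "(f z)\<^sup>2 + \<omega> * f z * deriv f z = f z * (f z + \<omega> * deriv f z)"
        by (simp add: power2_eq_square algebra_simps)
      then have "poly q z * exp (poly Q z) * f (z + c) = poly u z * exp (poly v z)"
        using assms(9)[of z] by (simp add: D True)
      moreover have "poly l (z + c) = poly l c + poly l z"
        using assms(2) by (simp add: l_def field_simps)
      then have "f (z + c) = C * exp (poly l c) * exp (poly l z)"
        unfolding C by (simp add: exp_add)
      ultimately have "poly q z * exp (poly Q z) * (C * exp (poly l c) * exp (poly l z)) = poly u z * exp (poly v z)"
        by simp
      then show ?thesis by (simp add: G_def exp_add exp_diff field_simps)
    qed
    have "degree G = 0"
    proof (rule ccontr)
      assume "degree G \<noteq> 0"
      \<comment> \<open>The type exponent \<open>1/2\<close> suits polynomials, which have every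
        positive type exponent, and lies below the degree of any nonconstant
        \<open>G\<close>.\<close>
      then have "(\<lambda>z. poly q z * (C * exp (poly l c))) z = 0" for z
        using eqG
        by (intro finite_type_mult_exp_eq_0[of "1/2" "\<lambda>z. poly q z * (C * exp (poly l c))" "poly u" G]
            finite_type_mult finite_type_poly finite_type_const) auto
      then have "\<forall>z. poly q z = 0" using C0 by simp
      then show False using assms(5) poly_all_0_iff_0 by blast
    qed
    then obtain g0 where G: "G = [:g0:]" by (rule degree_eq_zeroE)
    define L where "L = [:g0:] - l"
    have vQ: "v = Q + - L" using G by (auto simp: G_def L_def algebra_simps)
    have degL: "degree L = 1" using assms(2) by (simp add: L_def l_def)
    \<comment> \<open>Subtracting the linear \<open>L\<close> cannot affect a degree above 1. If
      \<open>Q\<close> is linear, then \<open>v\<close> has degree at most 1 and is nonconstant by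
      hypothesis.\<close>
    have deg_eq: "degree Q = degree v"
    proof (cases "degree Q > 1")
      case True
      then have "degree (Q + - L) = degree Q" by (intro degree_add_eq_left) (simp add: degL)
      then show ?thesis using vQ by simp
    next
      case False
      then have "degree (Q + - L) \<le> 1" using degL by (intro degree_add_le) auto
      then have "degree v \<le> 1" using vQ by simp
      then show ?thesis using False assms(3,4) by simp
    qed
    have "growth_order f = 1" using P(4) deg_p by simp
    \<comment> \<open>Order 1 is the second alternative if \<open>Q\<close> is linear and the first
      if its degree exceeds 1.\<close>
    then show ?thesis
      using deg_eq fC assms(3) by (cases "degree Q = 1") auto
  next
    case False
    \<comment> \<open>Division of the equation by \<open>exp (2 * p)\<close> leaves the exponents
      \<open>g\<close> and \<open>h\<close>, with coefficients of finite type
      \<open>\<rho>\<close>.\<close>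
    define pc where "pc = p \<circ>\<^sub>p [:c, 1:]"
    define g where "g = Q + pc - smult 2 p"
    define h where "h = v - smult 2 p"
    define A where "A = (\<lambda>z. P z * D z)"
    define B where "B = (\<lambda>z. poly q z * P (z + c))"
    have ft: "finite_type \<rho> A" "finite_type \<rho> B" "finite_type \<rho> (\<lambda>z. - 1 * poly u z)"
      unfolding A_def B_def using \<rho> ftP ftD
      by (intro finite_type_mult finite_type_poly finite_type_const finite_type_shift; simp)+
    have "\<exists>z. A z \<noteq> 0"
      using entire_mult_eq_0[OF holP finite_type_holomorphic[OF ftD]] False Pnz unfolding A_def by blast
    moreover have "\<exists>z. B z \<noteq> 0"
    proof (rule ccontr)
      assume "\<not> ?thesis"
      then have "(\<forall>z. poly q z = 0) \<or> (\<forall>z. P (z + c) = 0)"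
        using \<rho> by (intro entire_mult_eq_0 finite_type_holomorphic[OF finite_type_shift[OF _ ftP]] holomorphic_intros)
          (auto simp: B_def)
      then have "\<forall>z. P (z + c) = 0" using assms(5) poly_all_0_iff_0 by blast
      then have "P z = 0" for z by (metis diff_add_cancel)
      then show False using Pnz by blast
    qed
    moreover have "\<exists>z. - 1 * poly u z \<noteq> 0" using assms(6) poly_all_0_iff_0[of u] by auto
    moreover have "A z + B z * exp (poly g z) + - 1 * poly u z * exp (poly h z) = 0" for z
    proof -
      have "A z * (exp (poly p z) * exp (poly p z)) = (f z)\<^sup>2 + \<omega> * f z * deriv f z"
      proof -
        have "A z * (exp (poly p z) * exp (poly p z)) = (P z * exp (poly p z)) * (D z * exp (poly p z))"
          by (simp add: A_def mult_ac)
        also have "\<dots> = f z * (f z + \<omega> * deriv f z)" by (simp only: D P(5)[symmetric])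
        finally show ?thesis by (simp add: power2_eq_square algebra_simps)
      qed
      moreover have "B z * (exp (poly Q z) * exp (poly pc z)) = poly q z * exp (poly Q z) * f (z + c)"
        by (simp add: B_def P(5) pc_def poly_pcompose add.commute)
      ultimately have eq0: "A z * (exp (poly p z) * exp (poly p z)) + B z * (exp (poly Q z) * exp (poly pc z))
          - poly u z * exp (poly v z) = 0"
        using assms(9)[of z] by (simp only: diff_self)
      define E where "E = exp (poly p z) * exp (poly p z)"
      have E: "E \<noteq> 0" by (simp add: E_def)
      have eg: "exp (poly g z) = exp (poly Q z) * exp (poly pc z) / E"
        by (simp only: g_def E_def exp_add exp_diff mult_2 poly_add poly_diff poly_smult)
      have eh: "exp (poly h z) = exp (poly v z) / E"
        by (simp only: h_def E_def exp_add exp_diff mult_2 poly_diff poly_smult)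
      have "A z + B z * exp (poly g z) + - 1 * poly u z * exp (poly h z) =
          (A z * E + B z * (exp (poly Q z) * exp (poly pc z)) - poly u z * exp (poly v z)) / E"
        unfolding eg eh using E by (simp add: add_divide_distrib diff_divide_distrib)
      then show ?thesis by (simp only: eq0 E_def div_0)
    qed
    ultimately have "degree g \<le> \<rho> \<and> degree h \<le> \<rho>"
      using borel_degrees[OF ft \<rho>(1)] by blast
    \<comment> \<open>Both exponents have lost their terms of degree \<open>degree p\<close>, so the
      top coefficients of \<open>Q\<close> and \<open>v\<close> are those of \<open>p\<close> and of
      \<open>2 * p\<close>.\<close>
    then have gh: "degree g < degree p" "degree h < degree p" using \<rho>(2) by linarith+
    have "degree Q = degree p"
      using k gh(1) unfolding g_def pc_def by (rule degree_shift_cancel)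
    moreover have "degree v = degree p"
    proof -
      have "degree (smult 2 p) = degree p" by simp
      moreover have "v = h + smult 2 p" by (simp add: h_def)
      ultimately show ?thesis using gh(2) degree_add_eq_right[of h "smult 2 p"] by simp
    qed
    ultimately show ?thesis using P(4) by simp
  qed
qed

end
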